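(* Let $F$ be a ring, $G$ a finite group, $H$ a subgroup of $G$ and $K$ a subgroup of $H$. Let $A=F[G]$, $B=F[H]$, $C=F[K]$ be the group algebras. If the normal closure $K^G$ of $K$ in $G$ is contained in $H$, then the tower of rings $A\,|\,B\,|\,C$ is depth three (D3).
   Context: The tower $A\,|\,B\,|\,C$ consists of the inclusions $C\subseteq B\subseteq A$, with induced bimodule structures. It is right depth three if, as $A$-$C$-bimodules, $A\otimes_BA$ is isomorphic to a direct summand of $A^N$ for some positive integer $N$; it is left depth three if the same holds as $C$-$A$-bimodules; it is D3 if it is both left and right depth three. $K^G$ is the smallest normal subgroup of $G$ containing $K$. *)

theory Defs
  imports
    "HOL-Algebra.Free_Abelian_Groups"
    "HOL-Algebra.Generated_Groups"
    "HOL-Algebra.Subrings"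
begin

section \<open>Group algebras and normal closures\<close>

text \<open>
  The coefficient ring need not be commutative. Functions in the group algebra vanish outside the
  carrier of the group, so that for a subgroup \<open>H\<close> of \<open>G\<close> the carrier of
  \<open>group_algebra F (G\<lparr>carrier := H\<rparr>)\<close> is literally a subset of that of
  \<open>group_algebra F G\<close>.
\<close>

definition group_algebra ::
    "('f, 'r) ring_scheme \<Rightarrow> ('g, 's) monoid_scheme \<Rightarrow> ('g \<Rightarrow> 'f) ring" where
  "group_algebra F G =
    \<lparr>carrier = {f. f \<in> carrier G \<rightarrow> carrier F \<and> (\<forall>x. x \<notin> carrier G \<longrightarrow> f x = \<zero>\<^bsub>F\<^esub>) \<and>
                  finite {x. f x \<noteq> \<zero>\<^bsub>F\<^esub>}},
     monoid.mult = (\<lambda>f g x.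
        if x \<in> carrier G
        then \<Oplus>\<^bsub>F\<^esub>y \<in> {y \<in> carrier G. f y \<noteq> \<zero>\<^bsub>F\<^esub>}. f y \<otimes>\<^bsub>F\<^esub> g (inv\<^bsub>G\<^esub> y \<otimes>\<^bsub>G\<^esub> x)
        else \<zero>\<^bsub>F\<^esub>),
     one = (\<lambda>x. if x = \<one>\<^bsub>G\<^esub> then \<one>\<^bsub>F\<^esub> else \<zero>\<^bsub>F\<^esub>),
     zero = (\<lambda>x. \<zero>\<^bsub>F\<^esub>),
     add = (\<lambda>f g x. f x \<oplus>\<^bsub>F\<^esub> g x)\<rparr>"

definition normal_closure :: "('g, 's) monoid_scheme \<Rightarrow> 'g set \<Rightarrow> 'g set" where
  "normal_closure G K = \<Inter>{N. N \<lhd> G \<and> K \<subseteq> N}"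


section \<open>Bimodules\<close>

text \<open>
  As in \<^theory>\<open>HOL-Algebra.Free_Abelian_Groups\<close>, the addition of the underlying abelian group is the
  \<open>mult\<close> field of a monoid record, and its zero is the \<open>one\<close> field. The scalar rings are
  arguments of the predicates below rather than part of the record: restricting scalars to subrings
  changes these arguments only.
\<close>

record ('r, 's, 'm) bimodule = "'m monoid" +
  lsmult :: "'r \<Rightarrow> 'm \<Rightarrow> 'm"
  rsmult :: "'m \<Rightarrow> 's \<Rightarrow> 'm"

locale bimodule = R: ring R + S: ring S + comm_group M
  for R :: "('r, 'p) ring_scheme" (structure) and S :: "('s, 'q) ring_scheme" (structure)
    and M :: "('r, 's, 'm, 'z) bimodule_scheme" (structure) +
  assumes lsmult_closed: "\<lbrakk>r \<in> carrier R; x \<in> carrier M\<rbrakk> \<Longrightarrow> lsmult M r x \<in> carrier M"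
    and rsmult_closed: "\<lbrakk>s \<in> carrier S; x \<in> carrier M\<rbrakk> \<Longrightarrow> rsmult M x s \<in> carrier M"
    and lsmult_add: "\<lbrakk>r \<in> carrier R; x \<in> carrier M; y \<in> carrier M\<rbrakk> \<Longrightarrow>
          lsmult M r (x \<otimes>\<^bsub>M\<^esub> y) = lsmult M r x \<otimes>\<^bsub>M\<^esub> lsmult M r y"
    and rsmult_add: "\<lbrakk>s \<in> carrier S; x \<in> carrier M; y \<in> carrier M\<rbrakk> \<Longrightarrow>
          rsmult M (x \<otimes>\<^bsub>M\<^esub> y) s = rsmult M x s \<otimes>\<^bsub>M\<^esub> rsmult M y s"
    and add_lsmult: "\<lbrakk>r \<in> carrier R; r' \<in> carrier R; x \<in> carrier M\<rbrakk> \<Longrightarrow>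
          lsmult M (r \<oplus>\<^bsub>R\<^esub> r') x = lsmult M r x \<otimes>\<^bsub>M\<^esub> lsmult M r' x"
    and add_rsmult: "\<lbrakk>s \<in> carrier S; s' \<in> carrier S; x \<in> carrier M\<rbrakk> \<Longrightarrow>
          rsmult M x (s \<oplus>\<^bsub>S\<^esub> s') = rsmult M x s \<otimes>\<^bsub>M\<^esub> rsmult M x s'"
    and mult_lsmult: "\<lbrakk>r \<in> carrier R; r' \<in> carrier R; x \<in> carrier M\<rbrakk> \<Longrightarrow>
          lsmult M (r \<otimes>\<^bsub>R\<^esub> r') x = lsmult M r (lsmult M r' x)"
    and mult_rsmult: "\<lbrakk>s \<in> carrier S; s' \<in> carrier S; x \<in> carrier M\<rbrakk> \<Longrightarrow>
          rsmult M x (s \<otimes>\<^bsub>S\<^esub> s') = rsmult M (rsmult M x s) s'"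
    and one_lsmult: "x \<in> carrier M \<Longrightarrow> lsmult M \<one>\<^bsub>R\<^esub> x = x"
    and one_rsmult: "x \<in> carrier M \<Longrightarrow> rsmult M x \<one>\<^bsub>S\<^esub> = x"
    and lsmult_rsmult: "\<lbrakk>r \<in> carrier R; s \<in> carrier S; x \<in> carrier M\<rbrakk> \<Longrightarrow>
          rsmult M (lsmult M r x) s = lsmult M r (rsmult M x s)"

definition bimodule_iso ::
    "('r, 'p) ring_scheme \<Rightarrow> ('s, 'q) ring_scheme \<Rightarrow> ('r, 's, 'm, 'y) bimodule_scheme \<Rightarrow>
     ('r, 's, 'n, 'z) bimodule_scheme \<Rightarrow> ('m \<Rightarrow> 'n) set" where
  "bimodule_iso R S M N =
    {h \<in> iso M N.
       (\<forall>r\<in>carrier R. \<forall>x\<in>carrier M. h (lsmult M r x) = lsmult N r (h x)) \<and>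
       (\<forall>s\<in>carrier S. \<forall>x\<in>carrier M. h (rsmult M x s) = rsmult N (h x) s)}"

definition subbimodule ::
    "('r, 'p) ring_scheme \<Rightarrow> ('s, 'q) ring_scheme \<Rightarrow> 'm set \<Rightarrow> ('r, 's, 'm, 'z) bimodule_scheme \<Rightarrow> bool"
  where
  "subbimodule R S P M \<longleftrightarrow> subgroup P M \<and>
     (\<forall>r\<in>carrier R. \<forall>x\<in>P. lsmult M r x \<in> P) \<and> (\<forall>s\<in>carrier S. \<forall>x\<in>P. rsmult M x s \<in> P)"

definition direct_summand ::
    "('r, 'p) ring_scheme \<Rightarrow> ('s, 'q) ring_scheme \<Rightarrow> 'm set \<Rightarrow> ('r, 's, 'm, 'z) bimodule_scheme \<Rightarrow> bool"
  where
  "direct_summand R S P M \<longleftrightarrow> subbimodule R S P M \<and>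
     (\<exists>Q. subbimodule R S Q M \<and> P \<inter> Q = {\<one>\<^bsub>M\<^esub>} \<and> P <#>\<^bsub>M\<^esub> Q = carrier M)"

definition regular_bimodule :: "('a, 'z) ring_scheme \<Rightarrow> ('a, 'a, 'a) bimodule" where
  "regular_bimodule A =
    \<lparr>carrier = carrier A, monoid.mult = add A, one = zero A,
     lsmult = monoid.mult A, rsmult = monoid.mult A\<rparr>"

definition power_bimodule ::
    "nat \<Rightarrow> ('r, 's, 'm, 'z) bimodule_scheme \<Rightarrow> ('r, 's, nat \<Rightarrow> 'm) bimodule" where
  "power_bimodule n M =
    (let P = product_group {..<n} (\<lambda>_. M) in
      \<lparr>carrier = carrier P, monoid.mult = monoid.mult P, one = one P,
       lsmult = (\<lambda>r x. \<lambda>i\<in>{..<n}. lsmult M r (x i)),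
       rsmult = (\<lambda>x s. \<lambda>i\<in>{..<n}. rsmult M (x i) s)\<rparr>)"

lemma bimodule_regular_bimodule:
  "ring A \<Longrightarrow> subring B A \<Longrightarrow> subring C A \<Longrightarrow> bimodule (A\<lparr>carrier := B\<rparr>) (A\<lparr>carrier := C\<rparr>) (regular_bimodule A)"
proof -
  assume A: "ring A" and B: "subring B A" and C: "subring C A"
  have eq: "comm_group (regular_bimodule A) = comm_group (add_monoid A)"
    by (simp add: regular_bimodule_def comm_group_def group_def group_axioms_def comm_monoid_def
        comm_monoid_axioms_def monoid_def Units_def)
  interpret A: ring A by fact
  have 1: "ring (A\<lparr>carrier := B\<rparr>)" "ring (A\<lparr>carrier := C\<rparr>)" using A.subring_is_ring B C by auto
  have 2: "B \<subseteq> carrier A" "C \<subseteq> carrier A" using B C by (auto dest: subringE(1))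
  have 3: "comm_group (regular_bimodule A)"
    using A.a_comm_group eq by simp
  show ?thesis
    apply (intro bimodule.intro 1 3 bimodule_axioms.intro)
    using 2 by (auto simp: regular_bimodule_def A.l_distr A.r_distr A.m_assoc subset_iff)
qed


section \<open>Tensor products over a noncommutative ring\<close>

definition tensor_relations ::
    "('b, 'p) ring_scheme \<Rightarrow> ('r, 'b, 'm, 'y) bimodule_scheme \<Rightarrow> ('b, 's, 'n, 'z) bimodule_scheme \<Rightarrow>
     ('m \<times> 'n \<Rightarrow>\<^sub>0 int) set" where
  "tensor_relations B M N =
    generate (free_Abelian_group (carrier M \<times> carrier N))
     ({frag_of (x \<otimes>\<^bsub>M\<^esub> x', y) - frag_of (x, y) - frag_of (x', y) | x x' y.
         x \<in> carrier M \<and> x' \<in> carrier M \<and> y \<in> carrier N} \<union>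
      {frag_of (x, y \<otimes>\<^bsub>N\<^esub> y') - frag_of (x, y) - frag_of (x, y') | x y y'.
         x \<in> carrier M \<and> y \<in> carrier N \<and> y' \<in> carrier N} \<union>
      {frag_of (rsmult M x b, y) - frag_of (x, lsmult N b y) | x b y.
         x \<in> carrier M \<and> b \<in> carrier B \<and> y \<in> carrier N})"

text \<open>
  Elements of \<open>M \<otimes>\<^sub>B N\<close> are cosets of the subgroup \<open>U\<close> of relations in the free abelian group on
  \<open>M \<times> N\<close>. A scalar acts on a coset by acting on its members and adding \<open>U\<close> to the result, since
  the image of a coset under the action is in general only contained in a coset.
\<close>

definition tensor_bimodule ::
    "('b, 'p) ring_scheme \<Rightarrow> ('r, 'b, 'm, 'y) bimodule_scheme \<Rightarrow> ('b, 's, 'n, 'z) bimodule_scheme \<Rightarrow>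
     ('r, 's, ('m \<times> 'n \<Rightarrow>\<^sub>0 int) set) bimodule" where
  "tensor_bimodule B M N =
    (let L = free_Abelian_group (carrier M \<times> carrier N);
         U = tensor_relations B M N;
         Q = L Mod U
     in \<lparr>carrier = carrier Q, monoid.mult = monoid.mult Q, one = one Q,
         lsmult = (\<lambda>r X. U <#>\<^bsub>L\<^esub> frag_extend (\<lambda>(x, y). frag_of (lsmult M r x, y)) ` X),
         rsmult = (\<lambda>X s. U <#>\<^bsub>L\<^esub> frag_extend (\<lambda>(x, y). frag_of (x, rsmult N y s)) ` X)\<rparr>)"


text \<open>The scalar actions are well defined on cosets and make the tensor product a bimodule.\<close>

context
begin

private lemma frag_extend_generate:
  assumes \<phi>: "\<And>z. z \<in> X \<Longrightarrow> frag_extend f z \<in> generate (free_Abelian_group S) X"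
    and X: "X \<subseteq> carrier (free_Abelian_group S)"
    and z: "z \<in> generate (free_Abelian_group S) X"
  shows "frag_extend f z \<in> generate (free_Abelian_group S) X"
proof -
  interpret L: group "free_Abelian_group S" by simp
  have sub: "subgroup (generate (free_Abelian_group S) X) (free_Abelian_group S)"
    using L.generate_is_subgroup X by blast
  show ?thesis using z
  proof (induction rule: generate.induct)
    case one then show ?case using subgroup.one_closed[OF sub] by simp
  next
    case (incl h) then show ?case using \<phi> by blast
  next
    case (inv h)
    have k: "Poly_Mapping.keys h \<subseteq> S" using X inv(1) by (metis carrier_free_Abelian_group_iff subsetD)
    have "inv\<^bsub>free_Abelian_group S\<^esub> frag_extend f h \<in> generate (free_Abelian_group S) X"
      using subgroup.m_inv_closed[OF sub \<phi>[OF inv]] .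
    moreover have "Poly_Mapping.keys (frag_extend f h) \<subseteq> S"
      using subgroup.mem_carrier[OF sub \<phi>[OF inv]] by simp
    ultimately show ?case using k by (simp add: frag_extend_minus)
  next
    case (eng h1 h2)
    then show ?case using subgroup.m_closed[OF sub, of "frag_extend f h1" "frag_extend f h2"]
      by (simp add: frag_extend_add)
  qed
qed

private lemma act_coset:
  assumes sub: "subgroup U (free_Abelian_group S)"
    and \<phi>U: "\<And>z. z \<in> U \<Longrightarrow> frag_extend f z \<in> U"
  shows "U <#>\<^bsub>free_Abelian_group S\<^esub> frag_extend f ` (U #>\<^bsub>free_Abelian_group S\<^esub> a)
       = U #>\<^bsub>free_Abelian_group S\<^esub> frag_extend f a" (is "?l = ?r")
proof
  have c: "\<And>x y. x \<in> U \<Longrightarrow> y \<in> U \<Longrightarrow> x + y \<in> U"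
    using subgroup.m_closed[OF sub] by simp
  have o: "0 \<in> U" using subgroup.one_closed[OF sub] by simp
  show "?l \<subseteq> ?r"
    apply (auto simp: set_mult_def r_coset_def frag_extend_add)
    by (metis \<phi>U c add.assoc)
  show "?r \<subseteq> ?l"
    apply (auto simp: set_mult_def r_coset_def)
    by (metis o add_0)
qed

context
  fixes R :: "('r, 'p) ring_scheme" and B :: "('b, 'pp) ring_scheme" and S :: "('s, 'q) ring_scheme"
    and M :: "('r, 'b, 'm, 'y) bimodule_scheme" and N :: "('b, 's, 'n, 'z) bimodule_scheme"
  assumes M: "bimodule R B M" and N: "bimodule B S N"
begin
interpretation M: bimodule R B M by (rule M)
interpretation N: bimodule B S N by (rule N)

private abbreviation (input) "FL \<equiv> free_Abelian_group (carrier M \<times> carrier N)"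
private abbreviation (input) "U \<equiv> tensor_relations B M N"
private abbreviation (input) "T \<equiv> tensor_bimodule B M N"
interpretation FL: comm_group FL by (rule abelian_free_Abelian_group)

private lemma subL: "({frag_of (x \<otimes>\<^bsub>M\<^esub> x', y) - frag_of (x, y) - frag_of (x', y) | x x' y.
         x \<in> carrier M \<and> x' \<in> carrier M \<and> y \<in> carrier N} \<union>
      {frag_of (x, y \<otimes>\<^bsub>N\<^esub> y') - frag_of (x, y) - frag_of (x, y') | x y y'.
         x \<in> carrier M \<and> y \<in> carrier N \<and> y' \<in> carrier N} \<union>
      {frag_of (rsmult M x b, y) - frag_of (x, lsmult N b y) | x b y.
         x \<in> carrier M \<and> b \<in> carrier B \<and> y \<in> carrier N}) \<subseteq> carrier FL"
proof -
  have d: "\<And>a b. a \<in> carrier FL \<Longrightarrow> b \<in> carrier FL \<Longrightarrow> a - b \<in> carrier FL"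
    using keys_diff by (fastforce simp: subset_iff)
  have f: "x \<in> carrier M \<Longrightarrow> y \<in> carrier N \<Longrightarrow> frag_of (x, y) \<in> carrier FL" for x y
    by simp
  show ?thesis
    by (intro Un_least subsetI; elim CollectE exE conjE; hypsubst;
        intro d f M.rsmult_closed N.lsmult_closed M.m_closed N.m_closed; assumption)
qed

private lemma subU: "subgroup U FL" unfolding tensor_relations_def
  using subL by (rule FL.generate_is_subgroup)

private lemma rel1: "x \<in> carrier M \<Longrightarrow> x' \<in> carrier M \<Longrightarrow> y \<in> carrier N \<Longrightarrow> frag_of (x \<otimes>\<^bsub>M\<^esub> x', y) - frag_of (x, y) - frag_of (x', y) \<in> U"
  unfolding tensor_relations_def by (rule generate.incl) blast
private lemma rel2: "x \<in> carrier M \<Longrightarrow> y' \<in> carrier N \<Longrightarrow> y \<in> carrier N \<Longrightarrow> frag_of (x, y \<otimes>\<^bsub>N\<^esub> y') - frag_of (x, y) - frag_of (x, y') \<in> U"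
  unfolding tensor_relations_def by (rule generate.incl) blast
private lemma rel3: "x \<in> carrier M \<Longrightarrow> b \<in> carrier B \<Longrightarrow> y \<in> carrier N \<Longrightarrow> frag_of (rsmult M x b, y) - frag_of (x, lsmult N b y) \<in> U"
  unfolding tensor_relations_def by (rule generate.incl) blast

private abbreviation (input) "lf r \<equiv> (\<lambda>(x, y). frag_of (lsmult M r x, y))"
private abbreviation (input) "rf s \<equiv> (\<lambda>(x, y). frag_of (x, rsmult N y s))"

private lemma lU: assumes r: "r \<in> carrier R" and z: "z \<in> U" shows "frag_extend (lf r) z \<in> U"
  unfolding tensor_relations_def
  apply (rule frag_extend_generate[OF _ subL z[unfolded tensor_relations_def]])
  apply (fold tensor_relations_def)
  using rel1 rel2 rel3 r
  by (auto simp: frag_extend_diff M.lsmult_add M.lsmult_closed M.lsmult_rsmult[symmetric])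

private lemma rU: assumes r: "s \<in> carrier S" and z: "z \<in> U" shows "frag_extend (rf s) z \<in> U"
  unfolding tensor_relations_def
  apply (rule frag_extend_generate[OF _ subL z[unfolded tensor_relations_def]])
  apply (fold tensor_relations_def)
  using rel1 rel2 rel3 r
  by (auto simp: frag_extend_diff N.rsmult_add N.rsmult_closed N.lsmult_rsmult)

private lemma Teq: "carrier T = rcosets\<^bsub>FL\<^esub> U" "monoid.mult T = (<#>\<^bsub>FL\<^esub>)" "one T = U"
  by (simp_all add: tensor_bimodule_def FactGroup_def Let_def)

private lemma lT: "r \<in> carrier R \<Longrightarrow> lsmult T r (U #>\<^bsub>FL\<^esub> a) = U #>\<^bsub>FL\<^esub> frag_extend (lf r) a"
  by (simp add: tensor_bimodule_def Let_def act_coset[OF subU lU])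
private lemma rT: "r \<in> carrier S \<Longrightarrow> rsmult T (U #>\<^bsub>FL\<^esub> a) r = U #>\<^bsub>FL\<^esub> frag_extend (rf r) a"
  by (simp add: tensor_bimodule_def Let_def act_coset[OF subU rU])

private lemma keysl: "r \<in> carrier R \<Longrightarrow> a \<in> carrier FL \<Longrightarrow> frag_extend (lf r) a \<in> carrier FL"
  unfolding carrier_free_Abelian_group_iff
  by (rule subset_trans[OF keys_frag_extend]) (auto simp: M.lsmult_closed)
private lemma keysr: "r \<in> carrier S \<Longrightarrow> a \<in> carrier FL \<Longrightarrow> frag_extend (rf r) a \<in> carrier FL"
  unfolding carrier_free_Abelian_group_iff
  by (rule subset_trans[OF keys_frag_extend]) (auto simp: N.rsmult_closed)

private lemma cosI: "a \<in> carrier FL \<Longrightarrow> b \<in> carrier FL \<Longrightarrow> a - b \<in> U \<Longrightarrow> U #>\<^bsub>FL\<^esub> a = U #>\<^bsub>FL\<^esub> b"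
proof -
  assume a: "a \<in> carrier FL" "b \<in> carrier FL" "a - b \<in> U"
  then have "a \<in> U #>\<^bsub>FL\<^esub> b" by (auto simp: r_coset_def intro!: bexI[of _ "a-b"])
  then show ?thesis using FL.repr_independence[OF _ a(2) subU] by blast
qed

private lemma ind: assumes a: "a \<in> carrier FL" and p: "\<And>x y. x \<in> carrier M \<Longrightarrow> y \<in> carrier N \<Longrightarrow> g (frag_of (x,y)) \<in> U"
   and g: "\<And>a b. g (a - b) = g a - g b"
 shows "g a \<in> U"
proof -
  have g0: "g 0 = 0" using g[of 0 0] by simp
  have u0: "0 \<in> U" using subgroup.one_closed[OF subU] by simp
  have ud: "a \<in> U \<Longrightarrow> b \<in> U \<Longrightarrow> a - b \<in> U" for a b
  proof -
    assume ab: "a \<in> U" "b \<in> U"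
    have "b \<in> carrier FL" using subgroup.mem_carrier[OF subU ab(2)] .
    then show ?thesis using subgroup.m_closed[OF subU ab(1) subgroup.m_inv_closed[OF subU ab(2)]] by simp
  qed
  have "Poly_Mapping.keys a \<subseteq> carrier M \<times> carrier N" using a by simp
  then show ?thesis
    by (induction a rule: frag_induction) (auto simp: g0 u0 p g ud)
qed

private lemma sum: "a \<in> carrier FL \<Longrightarrow> b \<in> carrier FL \<Longrightarrow> (U #>\<^bsub>FL\<^esub> a) <#>\<^bsub>FL\<^esub> (U #>\<^bsub>FL\<^esub> b) = U #>\<^bsub>FL\<^esub> (a + b)"
  using normal.rcos_sum[OF FL.subgroup_imp_normal[OF subU]] by simp

private lemma ex: "X \<in> carrier T \<Longrightarrow> (\<And>a. a \<in> carrier FL \<Longrightarrow> P (U #>\<^bsub>FL\<^esub> a)) \<Longrightarrow> P X"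
  by (auto simp: Teq RCOSETS_def)
private lemma in_T: "a \<in> carrier FL \<Longrightarrow> U #>\<^bsub>FL\<^esub> a \<in> carrier T"
  by (auto simp: Teq RCOSETS_def)
private lemma plusL: "a \<in> carrier FL \<Longrightarrow> b \<in> carrier FL \<Longrightarrow> a + b \<in> carrier FL"
  using FL.m_closed by simp
private lemma ind2: assumes a: "a \<in> carrier FL" and c: "g a \<in> carrier FL" "h a \<in> carrier FL" and p: "\<And>x y. x \<in> carrier M \<Longrightarrow> y \<in> carrier N \<Longrightarrow> g (frag_of (x,y)) - h (frag_of (x,y)) \<in> U"
   and g: "\<And>a b. g (a - b) = g a - g b" "\<And>a b. h (a - b) = h a - h b"
 shows "U #>\<^bsub>FL\<^esub> g a = U #>\<^bsub>FL\<^esub> h a"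
  apply (rule cosI[OF c]) using ind[OF a, of "\<lambda>a. g a - h a"] p g by simp

private lemma u0: "0 \<in> U" using subgroup.one_closed[OF subU] by simp

private lemma commT: "comm_group T"
proof -
  have "comm_group (FL Mod U)" by (simp add: FL.abelian_FactGroup subU)
  moreover have "comm_group T = comm_group (FL Mod U)"
    by (simp add: tensor_bimodule_def Let_def comm_group_def group_def group_axioms_def comm_monoid_def comm_monoid_axioms_def monoid_def Units_def)
  ultimately show ?thesis by simp
qed

lemma bimodule_tensor_bimodule: "bimodule R S T"
proof -
  interpret T: comm_group T by (rule commT)
  show ?thesis
    apply unfold_locales
    subgoal by (erule ex) (simp add: lT in_T keysl del: carrier_free_Abelian_group_iff)
    subgoal by (erule ex) (simp add: rT in_T keysr del: carrier_free_Abelian_group_iff)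
    subgoal by (erule ex, erule ex) (simp add: lT in_T keysl Teq(2) sum plusL frag_extend_add del: carrier_free_Abelian_group_iff)
    subgoal by (erule ex, erule ex) (simp add: rT in_T keysr Teq(2) sum plusL frag_extend_add del: carrier_free_Abelian_group_iff)
    subgoal for r r' x
      apply (erule ex) apply (simp add: lT keysl Teq(2) sum del: carrier_free_Abelian_group_iff)
      apply (rule ind2[where h="\<lambda>a. frag_extend (lf r) a + frag_extend (lf r') a"])
      using rel1 by (auto simp: keysl plusL frag_extend_diff M.add_lsmult M.lsmult_closed diff_diff_eq[symmetric] simp del: carrier_free_Abelian_group_iff)
    subgoal for r r' x
      apply (erule ex) apply (simp add: rT keysr Teq(2) sum del: carrier_free_Abelian_group_iff)
      apply (rule ind2[where h="\<lambda>a. frag_extend (rf r) a + frag_extend (rf r') a"])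
      using rel2 by (auto simp: keysr plusL frag_extend_diff N.add_rsmult N.rsmult_closed diff_diff_eq[symmetric] simp del: carrier_free_Abelian_group_iff)
    subgoal for r r' x
      apply (erule ex) apply (simp add: lT keysl  del: carrier_free_Abelian_group_iff)
      apply (rule ind2[where h="\<lambda>a. frag_extend (lf r) (frag_extend (lf r') a)"])
      by (auto simp: keysl u0 frag_extend_diff M.mult_lsmult M.lsmult_closed  simp del: carrier_free_Abelian_group_iff)
    subgoal for r r' x
      apply (erule ex) apply (simp add: rT keysr  del: carrier_free_Abelian_group_iff)
      apply (rule ind2[where h="\<lambda>a. frag_extend (rf r') (frag_extend (rf r) a)"])
      by (auto simp: keysr u0 frag_extend_diff N.mult_rsmult N.rsmult_closed  simp del: carrier_free_Abelian_group_iff)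
    subgoal for x
      apply (erule ex) apply (simp add: lT  del: carrier_free_Abelian_group_iff)
      apply (rule ind2[where h="\<lambda>a. a"])
      by (auto simp: keysl u0 frag_extend_diff M.one_lsmult simp del: carrier_free_Abelian_group_iff)
    subgoal for x
      apply (erule ex) apply (simp add: rT  del: carrier_free_Abelian_group_iff)
      apply (rule ind2[where h="\<lambda>a. a"])
      by (auto simp: keysr u0 frag_extend_diff N.one_rsmult simp del: carrier_free_Abelian_group_iff)
    subgoal for r s x
      apply (erule ex) apply (simp add: lT rT  del: carrier_free_Abelian_group_iff)
      apply (rule ind2[where g="\<lambda>a. frag_extend (rf s) (frag_extend (lf r) a)" and h="\<lambda>a. frag_extend (lf r) (frag_extend (rf s) a)"])
      by (auto simp: keysr keysl u0 frag_extend_diff simp del: carrier_free_Abelian_group_iff)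
    done
qed
end

end


section \<open>Towers of rings of depth three\<close>

definition ring_tower :: "('a, 'z) ring_scheme \<Rightarrow> 'a set \<Rightarrow> 'a set \<Rightarrow> bool" where
  "ring_tower A B C \<longleftrightarrow> ring A \<and> subring B A \<and> subring C A \<and> C \<subseteq> B"

abbreviation tensor_square :: "('a, 'z) ring_scheme \<Rightarrow> 'a set \<Rightarrow>
    ('a, 'a, ('a \<times> 'a \<Rightarrow>\<^sub>0 int) set) bimodule" where
  "tensor_square A B \<equiv>
     tensor_bimodule (A\<lparr>carrier := B\<rparr>) (regular_bimodule A) (regular_bimodule A)"

definition right_depth_three :: "('a, 'z) ring_scheme \<Rightarrow> 'a set \<Rightarrow> 'a set \<Rightarrow> bool" where
  "right_depth_three A B C \<longleftrightarrow>
    (\<exists>n>0. \<exists>P. direct_summand A (A\<lparr>carrier := C\<rparr>) P (power_bimodule n (regular_bimodule A)) \<and>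
       bimodule_iso A (A\<lparr>carrier := C\<rparr>) (tensor_square A B)
         ((power_bimodule n (regular_bimodule A))\<lparr>carrier := P\<rparr>) \<noteq> {})"

definition left_depth_three :: "('a, 'z) ring_scheme \<Rightarrow> 'a set \<Rightarrow> 'a set \<Rightarrow> bool" where
  "left_depth_three A B C \<longleftrightarrow>
    (\<exists>n>0. \<exists>P. direct_summand (A\<lparr>carrier := C\<rparr>) A P (power_bimodule n (regular_bimodule A)) \<and>
       bimodule_iso (A\<lparr>carrier := C\<rparr>) A (tensor_square A B)
         ((power_bimodule n (regular_bimodule A))\<lparr>carrier := P\<rparr>) \<noteq> {})"

definition depth_three :: "('a, 'z) ring_scheme \<Rightarrow> 'a set \<Rightarrow> 'a set \<Rightarrow> bool" where
  "depth_three A B C \<longleftrightarrow> ring_tower A B C \<and> right_depth_three A B C \<and> left_depth_three A B C"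

end

theory Submission
  imports Defs
begin

text \<open>
  Let \<open>A = F[G]\<close>, \<open>B = F[H]\<close>, \<open>C = F[K]\<close>, and let \<open>t\<^sub>1, \<dots>, t\<^sub>n\<close> represent the right cosets of \<open>H\<close> in \<open>G\<close>.
  As a left \<open>B\<close>-module, \<open>A\<close> is the direct sum of the free modules \<open>B t\<^sub>i\<close>, so \<open>A \<otimes>\<^sub>B A\<close> is the direct sum
  of the subgroups \<open>A \<otimes> t\<^sub>i\<close>. Each of them is isomorphic to \<open>A\<close> by \<open>a \<otimes> t\<^sub>i \<mapsto> a t\<^sub>i\<close>, visibly as a left
  \<open>A\<close>-module. For \<open>k\<close> in \<open>K\<close> the conjugate \<open>t\<^sub>i k t\<^sub>i\<^sup>-\<^sup>1\<close> lies in the normal closure of \<open>K\<close>, hence in \<open>H\<close>, and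
  therefore \<open>(a \<otimes> t\<^sub>i) k = a \<otimes> (t\<^sub>i k t\<^sub>i\<^sup>-\<^sup>1) t\<^sub>i = a (t\<^sub>i k t\<^sub>i\<^sup>-\<^sup>1) \<otimes> t\<^sub>i\<close>. So each summand is stable under \<open>C\<close> on
  the right, and its isomorphism with \<open>A\<close> is one of \<open>A\<close>-\<open>C\<close>-bimodules. Thus \<open>A \<otimes>\<^sub>B A\<close> is isomorphic to
  all of \<open>A\<^sup>n\<close>, with \<open>n\<close> the index of \<open>H\<close>, not just to a direct summand. Left depth three follows in the
  same way from the decomposition of \<open>A\<close> along left cosets.

  In terms of functions on \<open>G\<close>, the projection of \<open>A\<close> onto \<open>B t\<^sub>i\<close> is restriction to the coset \<open>H t\<^sub>i\<close>. The
  isomorphism is \<open>x \<otimes> y \<mapsto> (x p\<^sub>i(y))\<^sub>i\<close> for these projections \<open>p\<^sub>i\<close>, and its inverse sends \<open>(a\<^sub>i)\<^sub>i\<close> to the sum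
  of the tensors \<open>a\<^sub>i t\<^sub>i\<^sup>-\<^sup>1 \<otimes> t\<^sub>i\<close>. The formal argument for arbitrary rings with such projections is
  \<open>right_depth_three_if_decomposition\<close> and its mirror image; it rests on the universal property of
  the tensor product. The lemmas \<open>restr_mult_left\<close> and \<open>restr_mult_right\<close> translate linearity of the
  restriction maps into stability of the cosets under multiplication.
\<close>

section \<open>Homomorphisms and finite products\<close>

lemma hom_finprod:
  assumes G: "comm_group G" and H: "comm_group H" and h: "h \<in> hom G H"
    and fin: "finite I" and f: "f \<in> I \<rightarrow> carrier G"
  shows "h (finprod G f I) = finprod H (\<lambda>i. h (f i)) I"
  using fin f
proof (induction I)
  case empty
  interpret G: comm_group G by fact
  interpret H: comm_group H by fact
  show ?case using hom_one[OF h] G.group_axioms H.group_axioms by simp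
next
  case (insert i I)
  interpret G: comm_group G by fact
  interpret H: comm_group H by fact
  have "(\<lambda>i. h (f i)) \<in> I \<rightarrow> carrier H" "h (f i) \<in> carrier H"
    using insert.prems hom_in_carrier[OF h] by (auto simp: Pi_iff)
  then show ?case using insert hom_mult[OF h] by (simp add: Pi_iff)
qed

lemma (in comm_monoid) finprod_swap:
  assumes "finite I" "finite J" "\<And>i j. \<lbrakk>i \<in> I; j \<in> J\<rbrakk> \<Longrightarrow> f i j \<in> carrier G"
  shows "(\<Otimes>i\<in>I. \<Otimes>j\<in>J. f i j) = (\<Otimes>j\<in>J. \<Otimes>i\<in>I. f i j)"
  using assms(1,3)
proof (induction I)
  case empty
  then show ?case by simp
next
  case (insert a I)
  have "(\<Otimes>i\<in>insert a I. \<Otimes>j\<in>J. f i j) = (\<Otimes>j\<in>J. f a j) \<otimes> (\<Otimes>j\<in>J. \<Otimes>i\<in>I. f i j)"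
    using insert by (subst finprod_insert) (auto intro!: finprod_closed)
  also have "\<dots> = (\<Otimes>j\<in>J. f a j \<otimes> (\<Otimes>i\<in>I. f i j))"
    using insert.prems by (intro finprod_multf[symmetric]) (auto intro!: finprod_closed)
  also have "\<dots> = (\<Otimes>j\<in>J. \<Otimes>i\<in>insert a I. f i j)"
    using insert by (intro finprod_cong') (auto intro!: finprod_closed)
  finally show ?case .
qed

section \<open>Pure tensors and the universal property\<close>

definition pure_tensor ::
    "('b, 'p) ring_scheme \<Rightarrow> ('r, 'b, 'm, 'y) bimodule_scheme \<Rightarrow> ('b, 's, 'n, 'z) bimodule_scheme \<Rightarrow>
     'm \<Rightarrow> 'n \<Rightarrow> ('m \<times> 'n \<Rightarrow>\<^sub>0 int) set" where
  "pure_tensor B M N x y =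
    tensor_relations B M N #>\<^bsub>free_Abelian_group (carrier M \<times> carrier N)\<^esub> frag_of (x, y)"

locale tensor_factors = M: bimodule R B M + N: bimodule B S N
  for R :: "('r, 'p) ring_scheme" and B :: "('b, 'pp) ring_scheme" and S :: "('s, 'q) ring_scheme"
    and M :: "('r, 'b, 'm, 'y) bimodule_scheme" and N :: "('b, 's, 'n, 'z) bimodule_scheme"
begin

abbreviation "L \<equiv> free_Abelian_group (carrier M \<times> carrier N)"
abbreviation "U \<equiv> tensor_relations B M N"
abbreviation "T \<equiv> tensor_bimodule B M N"
abbreviation pt (infixl "\<otimes>\<^sub>T" 75) where "x \<otimes>\<^sub>T y \<equiv> pure_tensor B M N x y"

sublocale L: comm_group L
  by (rule abelian_free_Abelian_group)

sublocale T: bimodule R S T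
  by (rule bimodule_tensor_bimodule[OF M.bimodule_axioms N.bimodule_axioms])

lemma diff_closed: "\<lbrakk>a \<in> carrier L; b \<in> carrier L\<rbrakk> \<Longrightarrow> a - b \<in> carrier L"
  using L.m_closed[of a "inv\<^bsub>L\<^esub> b"] L.inv_closed[of b] by simp

lemma add_closed: "\<lbrakk>a \<in> carrier L; b \<in> carrier L\<rbrakk> \<Longrightarrow> a + b \<in> carrier L"
  using L.m_closed[of a b] by simp

lemma frag_of_closed: "\<lbrakk>x \<in> carrier M; y \<in> carrier N\<rbrakk> \<Longrightarrow> frag_of (x, y) \<in> carrier L"
  by simp

lemma relations_mono:
  assumes "subgroup V L"
    and "\<And>x x' y. \<lbrakk>x \<in> carrier M; x' \<in> carrier M; y \<in> carrier N\<rbrakk> \<Longrightarrow>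
          frag_of (x \<otimes>\<^bsub>M\<^esub> x', y) - frag_of (x, y) - frag_of (x', y) \<in> V"
    and "\<And>x y y'. \<lbrakk>x \<in> carrier M; y \<in> carrier N; y' \<in> carrier N\<rbrakk> \<Longrightarrow>
          frag_of (x, y \<otimes>\<^bsub>N\<^esub> y') - frag_of (x, y) - frag_of (x, y') \<in> V"
    and "\<And>x b y. \<lbrakk>x \<in> carrier M; b \<in> carrier B; y \<in> carrier N\<rbrakk> \<Longrightarrow>
          frag_of (rsmult M x b, y) - frag_of (x, lsmult N b y) \<in> V"
  shows "U \<subseteq> V"
  unfolding tensor_relations_def
  by (rule L.generate_subgroup_incl[OF _ assms(1)]) (auto intro: assms(2-))

lemma subgroup_relations: "subgroup U L"
  unfolding tensor_relations_def
  by (rule L.generate_is_subgroup)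
    (auto intro!: diff_closed M.rsmult_closed N.lsmult_closed simp del: carrier_free_Abelian_group_iff)

lemma T_simps: "carrier T = carrier (L Mod U)" "monoid.mult T = monoid.mult (L Mod U)"
  by (simp_all add: tensor_bimodule_def Let_def)

lemma hom_T: "hom T Q = hom (L Mod U) Q"
  by (simp add: hom_def T_simps)

lemma coset_hom: "(\<lambda>a. U #>\<^bsub>L\<^esub> a) \<in> hom L T"
  using normal.r_coset_hom_Mod[OF L.subgroup_imp_normal[OF subgroup_relations]]
  by (simp add: hom_def T_simps)

lemma coset_closed: "a \<in> carrier L \<Longrightarrow> U #>\<^bsub>L\<^esub> a \<in> carrier T"
  using hom_in_carrier[OF coset_hom] .

lemma coset_add: "\<lbrakk>a \<in> carrier L; b \<in> carrier L\<rbrakk> \<Longrightarrow>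
    U #>\<^bsub>L\<^esub> (a + b) = (U #>\<^bsub>L\<^esub> a) \<otimes>\<^bsub>T\<^esub> (U #>\<^bsub>L\<^esub> b)"
  using hom_mult[OF coset_hom, of a b] by simp

lemma coset_eqI:
  assumes "b \<in> carrier L" "a - b \<in> U"
  shows "U #>\<^bsub>L\<^esub> a = U #>\<^bsub>L\<^esub> b"
proof -
  have "a \<in> U #>\<^bsub>L\<^esub> b"
    using assms(2) by (auto simp: r_coset_def intro!: bexI[of _ "a - b"])
  then show ?thesis using L.repr_independence assms(1) subgroup_relations by blast
qed

lemma pure_closed: "\<lbrakk>x \<in> carrier M; y \<in> carrier N\<rbrakk> \<Longrightarrow> x \<otimes>\<^sub>T y \<in> carrier T"
  unfolding pure_tensor_def by (intro coset_closed frag_of_closed)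

lemma pure_add_left:
  assumes "x \<in> carrier M" "x' \<in> carrier M" "y \<in> carrier N"
  shows "(x \<otimes>\<^bsub>M\<^esub> x') \<otimes>\<^sub>T y = (x \<otimes>\<^sub>T y) \<otimes>\<^bsub>T\<^esub> (x' \<otimes>\<^sub>T y)"
proof -
  have "frag_of (x \<otimes>\<^bsub>M\<^esub> x', y) - (frag_of (x, y) + frag_of (x', y)) \<in> U"
    unfolding diff_diff_eq[symmetric] tensor_relations_def
    by (rule generate.incl) (use assms in blast)
  then show ?thesis
    unfolding pure_tensor_def
    using assms by (subst coset_add[symmetric]) (auto intro!: coset_eqI add_closed frag_of_closed
        simp del: carrier_free_Abelian_group_iff)
qed

lemma pure_add_right:
  assumes "x \<in> carrier M" "y \<in> carrier N" "y' \<in> carrier N"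
  shows "x \<otimes>\<^sub>T (y \<otimes>\<^bsub>N\<^esub> y') = (x \<otimes>\<^sub>T y) \<otimes>\<^bsub>T\<^esub> (x \<otimes>\<^sub>T y')"
proof -
  have "frag_of (x, y \<otimes>\<^bsub>N\<^esub> y') - (frag_of (x, y) + frag_of (x, y')) \<in> U"
    unfolding diff_diff_eq[symmetric] tensor_relations_def
    by (rule generate.incl) (use assms in blast)
  then show ?thesis
    unfolding pure_tensor_def
    using assms by (subst coset_add[symmetric]) (auto intro!: coset_eqI add_closed frag_of_closed
        simp del: carrier_free_Abelian_group_iff)
qed

lemma pure_balanced:
  assumes "x \<in> carrier M" "b \<in> carrier B" "y \<in> carrier N"
  shows "rsmult M x b \<otimes>\<^sub>T y = x \<otimes>\<^sub>T lsmult N b y"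
proof -
  have "frag_of (rsmult M x b, y) - frag_of (x, lsmult N b y) \<in> U"
    unfolding tensor_relations_def by (rule generate.incl) (use assms in blast)
  then show ?thesis
    unfolding pure_tensor_def
    using assms by (intro coset_eqI frag_of_closed N.lsmult_closed)
qed

lemma coset_eq_if_mem:
  assumes "X \<in> carrier T" "a \<in> X"
  shows "X = U #>\<^bsub>L\<^esub> a"
proof -
  obtain c where "c \<in> carrier L" "X = U #>\<^bsub>L\<^esub> c"
    using assms(1) by (auto simp: T_simps FactGroup_def RCOSETS_def)
  then show ?thesis
    using L.repr_independence[OF _ _ subgroup_relations] assms(2) by blast
qed

text \<open>
  A scalar multiple of a coset is again a coset because the tensor product is a bimodule, so it is
  determined by any one of its members.
\<close>

lemma lsmult_pure:
  assumes "r \<in> carrier R" "x \<in> carrier M" "y \<in> carrier N"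
  shows "lsmult T r (x \<otimes>\<^sub>T y) = lsmult M r x \<otimes>\<^sub>T y"
proof -
  have 0: "0 \<in> U" using subgroup.one_closed[OF subgroup_relations] by simp
  have 1: "frag_of (x, y) \<in> x \<otimes>\<^sub>T y"
    unfolding pure_tensor_def
    using L.rcos_self[OF _ subgroup_relations] frag_of_closed[OF assms(2,3)] by blast
  have "0 + frag_extend (\<lambda>(x, y). frag_of (lsmult M r x, y)) (frag_of (x, y)) \<in> lsmult T r (x \<otimes>\<^sub>T y)"
    unfolding tensor_bimodule_def Let_def set_mult_def using 0 1 by force
  then show ?thesis
    unfolding pure_tensor_def[of _ _ _ "lsmult M r x"]
    using coset_eq_if_mem[OF T.lsmult_closed[OF assms(1) pure_closed[OF assms(2,3)]]] by simp
qed

lemma rsmult_pure: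
  assumes "s \<in> carrier S" "x \<in> carrier M" "y \<in> carrier N"
  shows "rsmult T (x \<otimes>\<^sub>T y) s = x \<otimes>\<^sub>T rsmult N y s"
proof -
  have 0: "0 \<in> U" using subgroup.one_closed[OF subgroup_relations] by simp
  have 1: "frag_of (x, y) \<in> x \<otimes>\<^sub>T y"
    unfolding pure_tensor_def
    using L.rcos_self[OF _ subgroup_relations] frag_of_closed[OF assms(2,3)] by blast
  have "0 + frag_extend (\<lambda>(x, y). frag_of (x, rsmult N y s)) (frag_of (x, y)) \<in> rsmult T (x \<otimes>\<^sub>T y) s"
    unfolding tensor_bimodule_def Let_def set_mult_def using 0 1 by force
  then show ?thesis
    unfolding pure_tensor_def[of _ _ _ x "rsmult N y s"]
    using coset_eq_if_mem[OF T.rsmult_closed[OF assms(1) pure_closed[OF assms(2,3)]]] by simp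
qed

text \<open>
  Pure tensors generate the tensor product as an abelian group, since already the classes of single
  pairs generate the free abelian group of which it is a quotient.
\<close>

lemma hom_ext:
  assumes "group Q" and f: "f \<in> hom T Q" and g: "g \<in> hom T Q"
    and eq: "\<And>x y. \<lbrakk>x \<in> carrier M; y \<in> carrier N\<rbrakk> \<Longrightarrow> f (x \<otimes>\<^sub>T y) = g (x \<otimes>\<^sub>T y)"
    and X: "X \<in> carrier T"
  shows "f X = g X"
proof -
  interpret f: group_hom T Q f using f assms(1) by (simp add: group_hom_def group_hom_axioms_def)
  interpret g: group_hom T Q g using g assms(1) by (simp add: group_hom_def group_hom_axioms_def)
  interpret c: group_hom L T "\<lambda>a. U #>\<^bsub>L\<^esub> a"
    using coset_hom by (simp add: group_hom_def group_hom_axioms_def)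
  obtain a where a: "a \<in> carrier L" "X = U #>\<^bsub>L\<^esub> a"
    using X by (auto simp: T_simps FactGroup_def RCOSETS_def)
  have diff: "a - b = a \<otimes>\<^bsub>L\<^esub> inv\<^bsub>L\<^esub> b" if "b \<in> carrier L" for a b
    using that by simp
  have "f (U #>\<^bsub>L\<^esub> a) = g (U #>\<^bsub>L\<^esub> a)"
    using a(1)[unfolded carrier_free_Abelian_group_iff]
  proof (rule free_Abelian_group_induct)
    show "f (U #>\<^bsub>L\<^esub> 0) = g (U #>\<^bsub>L\<^esub> 0)"
      using c.hom_one f.hom_one g.hom_one by simp
  next
    fix a b
    assume "Poly_Mapping.keys a \<subseteq> carrier M \<times> carrier N" "Poly_Mapping.keys b \<subseteq> carrier M \<times> carrier N"
      and eq: "f (U #>\<^bsub>L\<^esub> a) = g (U #>\<^bsub>L\<^esub> a)" "f (U #>\<^bsub>L\<^esub> b) = g (U #>\<^bsub>L\<^esub> b)"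
    then have "a \<in> carrier L" "b \<in> carrier L" by simp_all
    then show "f (U #>\<^bsub>L\<^esub> (a - b)) = g (U #>\<^bsub>L\<^esub> (a - b))"
      using eq by (simp add: diff del: carrier_free_Abelian_group_iff inv_free_Abelian_group
          mult_free_Abelian_group)
  next
    fix z assume "z \<in> carrier M \<times> carrier N"
    then show "f (U #>\<^bsub>L\<^esub> frag_of z) = g (U #>\<^bsub>L\<^esub> frag_of z)"
      using eq by (cases z) (simp add: pure_tensor_def)
  qed
  then show ?thesis using a(2) by simp
qed

text \<open>
  The map on pairs extends to the free abelian group, and biadditivity and balancedness say that the
  extension kills the three kinds of generating relations, so it factors through the quotient.
\<close>

lemma universal:
  assumes "comm_group Q"
    and f: "\<And>x y. \<lbrakk>x \<in> carrier M; y \<in> carrier N\<rbrakk> \<Longrightarrow> f x y \<in> carrier Q"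
    and f_left: "\<And>x x' y. \<lbrakk>x \<in> carrier M; x' \<in> carrier M; y \<in> carrier N\<rbrakk> \<Longrightarrow>
          f (x \<otimes>\<^bsub>M\<^esub> x') y = f x y \<otimes>\<^bsub>Q\<^esub> f x' y"
    and f_right: "\<And>x y y'. \<lbrakk>x \<in> carrier M; y \<in> carrier N; y' \<in> carrier N\<rbrakk> \<Longrightarrow>
          f x (y \<otimes>\<^bsub>N\<^esub> y') = f x y \<otimes>\<^bsub>Q\<^esub> f x y'"
    and f_balanced: "\<And>x b y. \<lbrakk>x \<in> carrier M; b \<in> carrier B; y \<in> carrier N\<rbrakk> \<Longrightarrow>
          f (rsmult M x b) y = f x (lsmult N b y)"
  obtains g where "g \<in> hom T Q"
    "\<And>x y. \<lbrakk>x \<in> carrier M; y \<in> carrier N\<rbrakk> \<Longrightarrow> g (x \<otimes>\<^sub>T y) = f x y"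
proof -
  interpret Q: comm_group Q by fact
  have "(\<lambda>(x, y). f x y) ` (carrier M \<times> carrier N) \<subseteq> carrier Q" using f by auto
  then obtain h where h: "h \<in> hom L Q"
    and h': "\<And>z. z \<in> carrier M \<times> carrier N \<Longrightarrow> h (frag_of z) = (\<lambda>(x, y). f x y) z"
    using Q.free_Abelian_group_universal by blast
  have h_of: "h (frag_of (x, y)) = f x y" if "x \<in> carrier M" "y \<in> carrier N" for x y
    using h' that by simp
  interpret h: group_hom L Q h using h by (simp add: group_hom_def group_hom_axioms_def)
  have ker: "a - b \<in> kernel L Q h" if "a \<in> carrier L" "b \<in> carrier L" "h a = h b" for a b
  proof -
    have "a - b = a \<otimes>\<^bsub>L\<^esub> inv\<^bsub>L\<^esub> b" using that by simp
    then have "h (a - b) = \<one>\<^bsub>Q\<^esub>"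
      using that by (simp del: carrier_free_Abelian_group_iff inv_free_Abelian_group
          mult_free_Abelian_group)
    then show ?thesis using that diff_closed by (auto simp: kernel_def)
  qed
  have h_add: "h (a + b) = h a \<otimes>\<^bsub>Q\<^esub> h b" if "a \<in> carrier L" "b \<in> carrier L" for a b
    using h.hom_mult[OF that] by simp
  have "U \<subseteq> kernel L Q h"
  proof (rule relations_mono[OF h.subgroup_kernel], unfold diff_diff_eq)
    show "frag_of (x \<otimes>\<^bsub>M\<^esub> x', y) - (frag_of (x, y) + frag_of (x', y)) \<in> kernel L Q h"
      if "x \<in> carrier M" "x' \<in> carrier M" "y \<in> carrier N" for x x' y
      using that by (intro ker frag_of_closed add_closed)
        (simp_all add: h_add h_of f_left frag_of_closed del: carrier_free_Abelian_group_iff)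
    show "frag_of (x, y \<otimes>\<^bsub>N\<^esub> y') - (frag_of (x, y) + frag_of (x, y')) \<in> kernel L Q h"
      if "x \<in> carrier M" "y \<in> carrier N" "y' \<in> carrier N" for x y y'
      using that by (intro ker frag_of_closed add_closed)
        (simp_all add: h_add h_of f_right frag_of_closed del: carrier_free_Abelian_group_iff)
    show "frag_of (rsmult M x b, y) - frag_of (x, lsmult N b y) \<in> kernel L Q h"
      if "x \<in> carrier M" "b \<in> carrier B" "y \<in> carrier N" for x b y
      using that by (intro ker frag_of_closed)
        (simp_all add: h_of f_balanced M.rsmult_closed N.lsmult_closed)
  qed
  then obtain g where "g \<in> hom (L Mod U) Q" "\<And>a. a \<in> carrier L \<Longrightarrow> g (U #>\<^bsub>L\<^esub> a) = h a"
    using h.FactGroup_universal_kernel[OF L.subgroup_imp_normal[OF subgroup_relations]] by blast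
  then show thesis
    using that h_of by (simp add: hom_T pure_tensor_def)
qed

end


section \<open>Isomorphisms onto powers of a bimodule\<close>

lemma power_bimodule_simps:
  "carrier (power_bimodule n M) = {..<n} \<rightarrow>\<^sub>E carrier M"
  "x \<otimes>\<^bsub>power_bimodule n M\<^esub> y = (\<lambda>i\<in>{..<n}. x i \<otimes>\<^bsub>M\<^esub> y i)"
  "\<one>\<^bsub>power_bimodule n M\<^esub> = (\<lambda>i\<in>{..<n}. \<one>\<^bsub>M\<^esub>)"
  "lsmult (power_bimodule n M) r x = (\<lambda>i\<in>{..<n}. lsmult M r (x i))"
  "rsmult (power_bimodule n M) x s = (\<lambda>i\<in>{..<n}. rsmult M (x i) s)"
  by (simp_all add: power_bimodule_def Let_def)

lemma group_power_bimodule: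
  assumes "group M"
  shows "group (power_bimodule n M)"
proof -
  interpret M: group M by fact
  show ?thesis
  proof (rule groupI; unfold power_bimodule_simps)
    fix x assume x: "x \<in> {..<n} \<rightarrow>\<^sub>E carrier M"
    show "(\<lambda>i\<in>{..<n}. (\<lambda>i\<in>{..<n}. \<one>\<^bsub>M\<^esub>) i \<otimes>\<^bsub>M\<^esub> x i) = x"
      using x by (auto simp: fun_eq_iff PiE_iff extensional_def)
    show "\<exists>y\<in>{..<n} \<rightarrow>\<^sub>E carrier M. (\<lambda>i\<in>{..<n}. y i \<otimes>\<^bsub>M\<^esub> x i) = (\<lambda>i\<in>{..<n}. \<one>\<^bsub>M\<^esub>)"
      using x by (intro bexI[of _ "\<lambda>i\<in>{..<n}. inv\<^bsub>M\<^esub> x i"]) (auto simp: fun_eq_iff PiE_iff)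
  qed (auto simp: PiE_iff M.m_assoc fun_eq_iff)
qed

text \<open>
  The complement is the zero submodule.
\<close>

lemma direct_summand_power_bimodule_self:
  assumes "bimodule R S M"
  shows "direct_summand R S (carrier (power_bimodule n M)) (power_bimodule n M)"
proof -
  interpret M: bimodule R S M by fact
  let ?P = "power_bimodule n M"
  interpret P: group ?P by (rule group_power_bimodule) (rule M.group_axioms)
  have l1: "lsmult M r \<one>\<^bsub>M\<^esub> = \<one>\<^bsub>M\<^esub>" if "r \<in> carrier R" for r
    using that M.lsmult_add[of r "\<one>\<^bsub>M\<^esub>" "\<one>\<^bsub>M\<^esub>"] M.lsmult_closed[of r "\<one>\<^bsub>M\<^esub>"]
    by (simp add: M.l_cancel_one)
  have r1: "rsmult M \<one>\<^bsub>M\<^esub> s = \<one>\<^bsub>M\<^esub>" if "s \<in> carrier S" for s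
    using that M.rsmult_add[of s "\<one>\<^bsub>M\<^esub>" "\<one>\<^bsub>M\<^esub>"] M.rsmult_closed[of s "\<one>\<^bsub>M\<^esub>"]
    by (simp add: M.l_cancel_one)
  have "subbimodule R S (carrier ?P) ?P"
    unfolding subbimodule_def
    by (intro conjI P.subgroup_self)
      (auto simp: power_bimodule_simps PiE_iff M.lsmult_closed M.rsmult_closed)
  moreover have "subbimodule R S {\<one>\<^bsub>?P\<^esub>} ?P"
    unfolding subbimodule_def
    by (intro conjI P.triv_subgroup) (auto simp: power_bimodule_simps l1 r1 fun_eq_iff)
  moreover have "carrier ?P <#>\<^bsub>?P\<^esub> {\<one>\<^bsub>?P\<^esub>} = carrier ?P"
    by (force simp: set_mult_def)
  ultimately show ?thesis
    unfolding direct_summand_def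
    by (intro conjI exI[of _ "{\<one>\<^bsub>?P\<^esub>}"]) (use P.one_closed in auto)
qed

text \<open>
  The usual description of a finite biproduct by projections \<open>\<phi>\<close> and injections \<open>\<iota>\<close>. The projections
  have to respect the scalars, but for the injections additivity is enough: they only serve to invert
  the map whose components are the projections, and an inverse of a bimodule bijection is linear.
\<close>

lemma bimodule_iso_power_bimodule:
  assumes T: "bimodule R S T" and M: "bimodule R S M"
    and \<phi>: "\<And>i. i < n \<Longrightarrow> \<phi> i \<in> hom T M"
    and \<phi>_left: "\<And>i r x. \<lbrakk>i < n; r \<in> carrier R; x \<in> carrier T\<rbrakk> \<Longrightarrow>
          \<phi> i (lsmult T r x) = lsmult M r (\<phi> i x)"
    and \<phi>_right: "\<And>i s x. \<lbrakk>i < n; s \<in> carrier S; x \<in> carrier T\<rbrakk> \<Longrightarrow>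
          \<phi> i (rsmult T x s) = rsmult M (\<phi> i x) s"
    and \<iota>: "\<And>i. i < n \<Longrightarrow> \<iota> i \<in> hom M T"
    and \<phi>_\<iota>: "\<And>i j a. \<lbrakk>i < n; j < n; a \<in> carrier M\<rbrakk> \<Longrightarrow>
          \<phi> j (\<iota> i a) = (if j = i then a else \<one>\<^bsub>M\<^esub>)"
    and \<iota>_\<phi>: "\<And>x. x \<in> carrier T \<Longrightarrow> (\<Otimes>\<^bsub>T\<^esub>i\<in>{..<n}. \<iota> i (\<phi> i x)) = x"
  shows "(\<lambda>x. \<lambda>i\<in>{..<n}. \<phi> i x) \<in> bimodule_iso R S T (power_bimodule n M)"
    (is "?\<Phi> \<in> _")
proof -
  interpret T: bimodule R S T by (rule T)
  interpret M: bimodule R S M by (rule M)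
  have \<phi>_closed: "\<phi> i x \<in> carrier M" if "i < n" "x \<in> carrier T" for i x
    by (rule hom_in_carrier[OF \<phi>[OF that(1)] that(2)])
  have \<iota>_closed: "\<iota> i a \<in> carrier T" if "i < n" "a \<in> carrier M" for i a
    by (rule hom_in_carrier[OF \<iota>[OF that(1)] that(2)])
  have "?\<Phi> \<in> hom T (power_bimodule n M)"
    by (rule homI) (auto simp: power_bimodule_simps \<phi>_closed hom_mult[OF \<phi>] fun_eq_iff)
  moreover have "bij_betw ?\<Phi> (carrier T) (carrier (power_bimodule n M))"
  proof (rule bij_betw_imageI)
    show "inj_on ?\<Phi> (carrier T)"
    proof (rule inj_onI)
      fix x y assume xy: "x \<in> carrier T" "y \<in> carrier T" "?\<Phi> x = ?\<Phi> y"
      have "\<phi> i x = \<phi> i y" if "i < n" for i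
        using fun_cong[OF xy(3), of i] that by simp
      then have "(\<Otimes>\<^bsub>T\<^esub>i\<in>{..<n}. \<iota> i (\<phi> i x)) = (\<Otimes>\<^bsub>T\<^esub>i\<in>{..<n}. \<iota> i (\<phi> i y))"
        using xy by (intro T.finprod_cong') (auto intro!: \<iota>_closed \<phi>_closed)
      then show "x = y" using \<iota>_\<phi> xy by simp
    qed
    show "?\<Phi> ` carrier T = carrier (power_bimodule n M)"
    proof (intro equalityI subsetI)
      fix a assume "a \<in> carrier (power_bimodule n M)"
      then have a: "a \<in> {..<n} \<rightarrow>\<^sub>E carrier M" by (simp add: power_bimodule_simps)
      let ?x = "\<Otimes>\<^bsub>T\<^esub>i\<in>{..<n}. \<iota> i (a i)"
      have x: "?x \<in> carrier T"
        using a by (intro T.finprod_closed) (auto intro!: \<iota>_closed)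
      have "\<phi> j ?x = a j" if j: "j < n" for j
      proof -
        have "\<phi> j ?x = (\<Otimes>\<^bsub>M\<^esub>i\<in>{..<n}. \<phi> j (\<iota> i (a i)))"
          using a by (intro hom_finprod[OF T.comm_group_axioms M.comm_group_axioms \<phi>[OF j]])
            (auto intro!: \<iota>_closed)
        also have "\<dots> = (\<Otimes>\<^bsub>M\<^esub>i\<in>{..<n}. if j = i then a i else \<one>\<^bsub>M\<^esub>)"
        proof (rule M.finprod_cong'[OF refl])
          fix i assume "i \<in> {..<n}"
          then show "\<phi> j (\<iota> i (a i)) = (if j = i then a i else \<one>\<^bsub>M\<^esub>)"
            using \<phi>_\<iota>[of i j "a i"] a j by (simp add: PiE_iff)
        qed (use a in \<open>simp add: PiE_iff Pi_iff\<close>)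
        also have "\<dots> = a j"
          using a j by (intro M.finprod_singleton[where f = a]) (simp_all add: PiE_iff Pi_iff)
        finally show ?thesis .
      qed
      then have "?\<Phi> ?x = a"
        using a by (auto simp: fun_eq_iff PiE_iff extensional_def)
      then show "a \<in> ?\<Phi> ` carrier T" by (rule image_eqI[OF sym x])
    next
      show "a \<in> carrier (power_bimodule n M)" if "a \<in> ?\<Phi> ` carrier T" for a
        using that \<phi>_closed by (force simp: power_bimodule_simps)
    qed
  qed
  ultimately show ?thesis
    by (simp add: bimodule_iso_def iso_def power_bimodule_simps \<phi>_left \<phi>_right cong: restrict_cong)
qed

text \<open>
  Everything is checked on pure tensors. The projections come from balanced maps \<open>f i\<close> by the
  universal property. The \<open>i\<close>-th injection sends \<open>a\<close> to the pure tensor of \<open>\<sigma> i a\<close> and \<open>\<tau> i a\<close>; a single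
  pure tensor is general enough when, as below, one of the two entries is constant in \<open>a\<close> and the
  other is additive in it.
\<close>

lemma (in tensor_factors) tensor_bimodule_iso_power:
  assumes Q: "bimodule R S Q"
    and f: "\<And>i x y. \<lbrakk>i < n; x \<in> carrier M; y \<in> carrier N\<rbrakk> \<Longrightarrow> f i x y \<in> carrier Q"
    and f_left: "\<And>i x x' y. \<lbrakk>i < n; x \<in> carrier M; x' \<in> carrier M; y \<in> carrier N\<rbrakk> \<Longrightarrow>
          f i (x \<otimes>\<^bsub>M\<^esub> x') y = f i x y \<otimes>\<^bsub>Q\<^esub> f i x' y"
    and f_right: "\<And>i x y y'. \<lbrakk>i < n; x \<in> carrier M; y \<in> carrier N; y' \<in> carrier N\<rbrakk> \<Longrightarrow>
          f i x (y \<otimes>\<^bsub>N\<^esub> y') = f i x y \<otimes>\<^bsub>Q\<^esub> f i x y'"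
    and f_balanced: "\<And>i x b y. \<lbrakk>i < n; x \<in> carrier M; b \<in> carrier B; y \<in> carrier N\<rbrakk> \<Longrightarrow>
          f i (rsmult M x b) y = f i x (lsmult N b y)"
    and f_lsmult: "\<And>i r x y. \<lbrakk>i < n; r \<in> carrier R; x \<in> carrier M; y \<in> carrier N\<rbrakk> \<Longrightarrow>
          f i (lsmult M r x) y = lsmult Q r (f i x y)"
    and f_rsmult: "\<And>i s x y. \<lbrakk>i < n; s \<in> carrier S; x \<in> carrier M; y \<in> carrier N\<rbrakk> \<Longrightarrow>
          f i x (rsmult N y s) = rsmult Q (f i x y) s"
    and \<sigma>: "\<And>i a. \<lbrakk>i < n; a \<in> carrier Q\<rbrakk> \<Longrightarrow> \<sigma> i a \<in> carrier M"
    and \<tau>: "\<And>i a. \<lbrakk>i < n; a \<in> carrier Q\<rbrakk> \<Longrightarrow> \<tau> i a \<in> carrier N"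
    and \<iota>: "\<And>i. i < n \<Longrightarrow> (\<lambda>a. \<sigma> i a \<otimes>\<^sub>T \<tau> i a) \<in> hom Q T"
    and f_\<iota>: "\<And>i j a. \<lbrakk>i < n; j < n; a \<in> carrier Q\<rbrakk> \<Longrightarrow>
          f j (\<sigma> i a) (\<tau> i a) = (if j = i then a else \<one>\<^bsub>Q\<^esub>)"
    and \<iota>_f: "\<And>x y. \<lbrakk>x \<in> carrier M; y \<in> carrier N\<rbrakk> \<Longrightarrow>
          (\<Otimes>\<^bsub>T\<^esub>i\<in>{..<n}. \<sigma> i (f i x y) \<otimes>\<^sub>T \<tau> i (f i x y)) = x \<otimes>\<^sub>T y"
  shows "bimodule_iso R S T (power_bimodule n Q) \<noteq> {}"
proof -
  interpret Q: bimodule R S Q by (rule Q)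
  have "\<exists>g. g \<in> hom T Q \<and> (\<forall>x\<in>carrier M. \<forall>y\<in>carrier N. g (x \<otimes>\<^sub>T y) = f i x y)"
    if i: "i < n" for i
    by (rule universal[OF Q.comm_group_axioms, of "f i"]; (intro f f_left f_right f_balanced i)?) blast+
  then obtain \<phi> where \<phi>: "\<And>i. i < n \<Longrightarrow> \<phi> i \<in> hom T Q"
    and \<phi>_pure: "\<And>i x y. \<lbrakk>i < n; x \<in> carrier M; y \<in> carrier N\<rbrakk> \<Longrightarrow> \<phi> i (x \<otimes>\<^sub>T y) = f i x y"
    by metis
  have \<phi>_closed: "\<phi> i x \<in> carrier Q" if "i < n" "x \<in> carrier T" for i x
    by (rule hom_in_carrier[OF \<phi>[OF that(1)] that(2)])
  have \<iota>_closed: "\<sigma> i a \<otimes>\<^sub>T \<tau> i a \<in> carrier T" if "i < n" "a \<in> carrier Q" for i a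
    by (rule hom_in_carrier[OF \<iota>[OF that(1)] that(2)])
  show ?thesis
  proof (rule ex_in_conv[THEN iffD1, OF exI], rule bimodule_iso_power_bimodule)
    fix i r X assume i: "i < n" and r: "r \<in> carrier R" and X: "X \<in> carrier T"
    show "\<phi> i (lsmult T r X) = lsmult Q r (\<phi> i X)"
    proof (rule hom_ext[OF Q.group_axioms _ _ _ X])
      show "(\<lambda>X. \<phi> i (lsmult T r X)) \<in> hom T Q"
        using i r by (intro homI)
          (auto simp: \<phi>_closed T.lsmult_closed T.lsmult_add hom_mult[OF \<phi>])
      show "(\<lambda>X. lsmult Q r (\<phi> i X)) \<in> hom T Q"
        using i r by (intro homI)
          (auto simp: \<phi>_closed Q.lsmult_closed Q.lsmult_add hom_mult[OF \<phi>])
      show "\<phi> i (lsmult T r (x \<otimes>\<^sub>T y)) = lsmult Q r (\<phi> i (x \<otimes>\<^sub>T y))"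
        if "x \<in> carrier M" "y \<in> carrier N" for x y
        using that i r by (simp add: lsmult_pure \<phi>_pure f_lsmult M.lsmult_closed)
    qed
  next
    fix i s X assume i: "i < n" and s: "s \<in> carrier S" and X: "X \<in> carrier T"
    show "\<phi> i (rsmult T X s) = rsmult Q (\<phi> i X) s"
    proof (rule hom_ext[OF Q.group_axioms _ _ _ X])
      show "(\<lambda>X. \<phi> i (rsmult T X s)) \<in> hom T Q"
        using i s by (intro homI)
          (auto simp: \<phi>_closed T.rsmult_closed T.rsmult_add hom_mult[OF \<phi>])
      show "(\<lambda>X. rsmult Q (\<phi> i X) s) \<in> hom T Q"
        using i s by (intro homI)
          (auto simp: \<phi>_closed Q.rsmult_closed Q.rsmult_add hom_mult[OF \<phi>])
      show "\<phi> i (rsmult T (x \<otimes>\<^sub>T y) s) = rsmult Q (\<phi> i (x \<otimes>\<^sub>T y)) s"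
        if "x \<in> carrier M" "y \<in> carrier N" for x y
        using that i s by (simp add: rsmult_pure \<phi>_pure f_rsmult N.rsmult_closed)
    qed
  next
    fix i j a assume "i < n" "j < n" "a \<in> carrier Q"
    then show "\<phi> j (\<sigma> i a \<otimes>\<^sub>T \<tau> i a) = (if j = i then a else \<one>\<^bsub>Q\<^esub>)"
      by (simp add: \<phi>_pure \<sigma> \<tau> f_\<iota>)
  next
    fix X assume X: "X \<in> carrier T"
    show "(\<Otimes>\<^bsub>T\<^esub>i\<in>{..<n}. \<sigma> i (\<phi> i X) \<otimes>\<^sub>T \<tau> i (\<phi> i X)) = X"
    proof (rule hom_ext[OF T.group_axioms _ _ _ X])
      show "(\<lambda>X. \<Otimes>\<^bsub>T\<^esub>i\<in>{..<n}. \<sigma> i (\<phi> i X) \<otimes>\<^sub>T \<tau> i (\<phi> i X)) \<in> hom T T"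
      proof (rule homI)
        fix X Y assume XY: "X \<in> carrier T" "Y \<in> carrier T"
        show "(\<Otimes>\<^bsub>T\<^esub>i\<in>{..<n}. \<sigma> i (\<phi> i X) \<otimes>\<^sub>T \<tau> i (\<phi> i X)) \<in> carrier T"
          using XY by (auto intro!: T.finprod_closed \<iota>_closed \<phi>_closed)
        have "(\<Otimes>\<^bsub>T\<^esub>i\<in>{..<n}. \<sigma> i (\<phi> i (X \<otimes>\<^bsub>T\<^esub> Y)) \<otimes>\<^sub>T \<tau> i (\<phi> i (X \<otimes>\<^bsub>T\<^esub> Y))) =
            (\<Otimes>\<^bsub>T\<^esub>i\<in>{..<n}. (\<sigma> i (\<phi> i X) \<otimes>\<^sub>T \<tau> i (\<phi> i X)) \<otimes>\<^bsub>T\<^esub> (\<sigma> i (\<phi> i Y) \<otimes>\<^sub>T \<tau> i (\<phi> i Y)))"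
          using XY hom_mult[OF \<iota>] hom_mult[OF \<phi>]
          by (intro T.finprod_cong') (auto intro!: T.m_closed \<iota>_closed \<phi>_closed simp: \<phi>_closed)
        also have "\<dots> = (\<Otimes>\<^bsub>T\<^esub>i\<in>{..<n}. \<sigma> i (\<phi> i X) \<otimes>\<^sub>T \<tau> i (\<phi> i X)) \<otimes>\<^bsub>T\<^esub>
            (\<Otimes>\<^bsub>T\<^esub>i\<in>{..<n}. \<sigma> i (\<phi> i Y) \<otimes>\<^sub>T \<tau> i (\<phi> i Y))"
          using XY by (intro T.finprod_multf) (auto intro!: \<iota>_closed \<phi>_closed)
        finally show "(\<Otimes>\<^bsub>T\<^esub>i\<in>{..<n}. \<sigma> i (\<phi> i (X \<otimes>\<^bsub>T\<^esub> Y)) \<otimes>\<^sub>T \<tau> i (\<phi> i (X \<otimes>\<^bsub>T\<^esub> Y))) =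
            (\<Otimes>\<^bsub>T\<^esub>i\<in>{..<n}. \<sigma> i (\<phi> i X) \<otimes>\<^sub>T \<tau> i (\<phi> i X)) \<otimes>\<^bsub>T\<^esub>
            (\<Otimes>\<^bsub>T\<^esub>i\<in>{..<n}. \<sigma> i (\<phi> i Y) \<otimes>\<^sub>T \<tau> i (\<phi> i Y))" .
      qed
      show "(\<lambda>X. X) \<in> hom T T" by (rule homI) simp_all
      show "(\<Otimes>\<^bsub>T\<^esub>i\<in>{..<n}. \<sigma> i (\<phi> i (x \<otimes>\<^sub>T y)) \<otimes>\<^sub>T \<tau> i (\<phi> i (x \<otimes>\<^sub>T y))) = x \<otimes>\<^sub>T y"
        if "x \<in> carrier M" "y \<in> carrier N" for x y
        using that \<iota>_f[OF that]
        by (subst T.finprod_cong'[where g = "\<lambda>i. \<sigma> i (f i x y) \<otimes>\<^sub>T \<tau> i (f i x y)", OF refl])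
          (auto simp: \<phi>_pure intro!: \<iota>_closed f)
    qed
  qed (use \<phi> \<iota> T.bimodule_axioms Q.bimodule_axioms in auto)
qed

section \<open>A criterion for depth three\<close>

lemma regular_bimodule_simps:
  "carrier (regular_bimodule A) = carrier A"
  "x \<otimes>\<^bsub>regular_bimodule A\<^esub> y = x \<oplus>\<^bsub>A\<^esub> y"
  "\<one>\<^bsub>regular_bimodule A\<^esub> = \<zero>\<^bsub>A\<^esub>"
  "lsmult (regular_bimodule A) r x = r \<otimes>\<^bsub>A\<^esub> x"
  "rsmult (regular_bimodule A) x r = x \<otimes>\<^bsub>A\<^esub> r"
  by (simp_all add: regular_bimodule_def)

lemma finprod_regular_bimodule: "finprod (regular_bimodule A) f I = finsum A f I"
  by (simp add: finprod_def finsum_def regular_bimodule_def)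

text \<open>
  Think of \<open>p i\<close> as the projection of \<open>R\<close> onto the summand \<open>B u\<^sub>i\<close> of a decomposition \<open>R = \<Oplus>\<^sub>i B u\<^sub>i\<close> as
  a left \<open>B\<close>-module, where \<open>v\<^sub>i u\<^sub>i = 1\<close>. Then \<open>R \<otimes>\<^sub>B R\<close> is the direct sum of the groups
  \<open>R \<otimes> u\<^sub>i\<close>, each of which is identified with \<open>R\<close> by \<open>x \<otimes> u\<^sub>i \<mapsto> x u\<^sub>i\<close>. The inverse is
  \<open>a \<mapsto> a v\<^sub>i \<otimes> u\<^sub>i\<close>, and the isomorphism \<open>x \<otimes> y \<mapsto> (x p\<^sub>i(y))\<^sub>i\<close> onto \<open>R\<^sup>n\<close> is right \<open>C\<close>-linear because
  the projections are.
\<close>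

lemma (in ring) right_depth_three_if_decomposition:
  fixes n :: nat
  assumes B: "subring B R" and C: "subring C R" and n: "0 < n"
    and p: "\<And>i. i < n \<Longrightarrow> p i \<in> hom (add_monoid R) (add_monoid R)"
    and p_left: "\<And>i b y. \<lbrakk>i < n; b \<in> B; y \<in> carrier R\<rbrakk> \<Longrightarrow> p i (b \<otimes> y) = b \<otimes> p i y"
    and p_right: "\<And>i y c. \<lbrakk>i < n; y \<in> carrier R; c \<in> C\<rbrakk> \<Longrightarrow> p i (y \<otimes> c) = p i y \<otimes> c"
    and p_sum: "\<And>y. y \<in> carrier R \<Longrightarrow> (\<Oplus>i\<in>{..<n}. p i y) = y"
    and u: "\<And>i. i < n \<Longrightarrow> u i \<in> carrier R" and v: "\<And>i. i < n \<Longrightarrow> v i \<in> carrier R"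
    and vu: "\<And>i. i < n \<Longrightarrow> v i \<otimes> u i = \<one>"
    and p_u: "\<And>i j. \<lbrakk>i < n; j < n\<rbrakk> \<Longrightarrow> p j (u i) = (if j = i then u i else \<zero>)"
    and p_v: "\<And>i y. \<lbrakk>i < n; y \<in> carrier R\<rbrakk> \<Longrightarrow> p i y \<otimes> v i \<in> B"
  shows "right_depth_three R B C"
proof -
  let ?V = "regular_bimodule R" and ?B = "R\<lparr>carrier := B\<rparr>" and ?C = "R\<lparr>carrier := C\<rparr>"
  note V = regular_bimodule_simps
  note bim = bimodule_regular_bimodule[OF ring_axioms]
  have VB: "bimodule R ?B ?V" and VC: "bimodule R ?C ?V"
    using bim[OF carrier_is_subring B] bim[OF carrier_is_subring C] by simp_all
  interpret T: tensor_factors R ?B ?C ?V ?V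
    using VB bim[OF B C] by (simp add: tensor_factors_def)
  have B_sub: "b \<in> carrier R" if "b \<in> B" for b using subringE(1)[OF B] that by blast
  have C_sub: "c \<in> carrier R" if "c \<in> C" for c using subringE(1)[OF C] that by blast
  have p_closed: "p i y \<in> carrier R" if "i < n" "y \<in> carrier R" for i y
    using hom_in_carrier[OF p] that by simp
  have p_add: "p i (y \<oplus> y') = p i y \<oplus> p i y'" if "i < n" "y \<in> carrier R" "y' \<in> carrier R" for i y y'
    using hom_mult[OF p] that by simp
  have "bimodule_iso R ?C T.T (power_bimodule n ?V) \<noteq> {}"
  proof (rule T.tensor_bimodule_iso_power[where f = "\<lambda>i x y. x \<otimes> p i y" and
        \<sigma> = "\<lambda>i a. a \<otimes> v i" and \<tau> = "\<lambda>i a. u i", OF VC]; (unfold V)?)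
    fix i assume i: "i < n"
    show "(\<lambda>a. pure_tensor ?B ?V ?V (a \<otimes> v i) (u i)) \<in> hom ?V T.T"
    proof (rule homI)
      fix a a' assume "a \<in> carrier ?V" "a' \<in> carrier ?V"
      then show "pure_tensor ?B ?V ?V ((a \<otimes>\<^bsub>?V\<^esub> a') \<otimes> v i) (u i) =
          pure_tensor ?B ?V ?V (a \<otimes> v i) (u i) \<otimes>\<^bsub>T.T\<^esub> pure_tensor ?B ?V ?V (a' \<otimes> v i) (u i)"
        using T.pure_add_left[of "a \<otimes> v i" "a' \<otimes> v i" "u i"] i u v
        by (simp add: V l_distr)
    qed (use i u v T.pure_closed in \<open>simp add: V\<close>)
  next
    fix i j a assume "i < n" "j < n" "a \<in> carrier R"
    then show "a \<otimes> v i \<otimes> p j (u i) = (if j = i then a else \<zero>)"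
      using u v by (simp add: p_u m_assoc vu)
  next
    fix x y assume x: "x \<in> carrier R" and y: "y \<in> carrier R"
    \<comment> \<open>The factor \<open>p i y \<otimes> v i\<close> lies in \<open>B\<close>, so it may be moved across the tensor sign, where \<open>v i\<close> cancels \<open>u i\<close>.\<close>
    have "(\<Otimes>\<^bsub>T.T\<^esub>i\<in>{..<n}. pure_tensor ?B ?V ?V (x \<otimes> p i y \<otimes> v i) (u i)) =
        (\<Otimes>\<^bsub>T.T\<^esub>i\<in>{..<n}. pure_tensor ?B ?V ?V x (p i y))"
    proof (rule T.T.finprod_cong'[OF refl])
      fix i assume "i \<in> {..<n}"
      then have i: "i < n" by simp
      have "pure_tensor ?B ?V ?V (x \<otimes> p i y \<otimes> v i) (u i) =
          pure_tensor ?B ?V ?V (rsmult ?V x (p i y \<otimes> v i)) (u i)"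
        using x y i v p_closed by (simp add: V m_assoc)
      also have "\<dots> = pure_tensor ?B ?V ?V x (lsmult ?V (p i y \<otimes> v i) (u i))"
        using x y i u p_v by (intro T.pure_balanced) (simp_all add: V)
      also have "lsmult ?V (p i y \<otimes> v i) (u i) = p i y"
        using y i u v p_closed by (simp add: V m_assoc vu)
      finally show "pure_tensor ?B ?V ?V (x \<otimes> p i y \<otimes> v i) (u i) = pure_tensor ?B ?V ?V x (p i y)" .
    qed (use x y p_closed T.pure_closed in \<open>simp add: V Pi_iff\<close>)
    also have "\<dots> = pure_tensor ?B ?V ?V x (finprod ?V (\<lambda>i. p i y) {..<n})"
    proof (rule hom_finprod[symmetric, OF T.M.comm_group_axioms T.T.comm_group_axioms])
      show "pure_tensor ?B ?V ?V x \<in> hom ?V T.T"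
        using T.pure_closed[of x] T.pure_add_right[of x] x by (intro homI) (simp_all add: V)
    qed (use y p_closed in \<open>auto simp: V\<close>)
    also have "finprod ?V (\<lambda>i. p i y) {..<n} = y"
      using y by (simp add: finprod_regular_bimodule p_sum)
    finally show "(\<Otimes>\<^bsub>T.T\<^esub>i\<in>{..<n}. pure_tensor ?B ?V ?V (x \<otimes> p i y \<otimes> v i) (u i)) =
        pure_tensor ?B ?V ?V x y" .
  qed (use u v p_closed B_sub C_sub in
      \<open>simp_all add: p_add p_left p_right l_distr r_distr m_assoc\<close>)
  then show ?thesis
    unfolding right_depth_three_def
    using n direct_summand_power_bimodule_self[OF VC]
    by (intro exI[of _ n] conjI exI[of _ "carrier (power_bimodule n ?V)"]) simp_all
qed

text \<open>
  The mirror image: \<open>R = \<Oplus>\<^sub>i u\<^sub>i B\<close> as a right \<open>B\<close>-module, with \<open>u\<^sub>i v\<^sub>i = 1\<close>. The isomorphism is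
  \<open>x \<otimes> y \<mapsto> (p\<^sub>i(x) y)\<^sub>i\<close>, and the injections are \<open>a \<mapsto> u\<^sub>i \<otimes> v\<^sub>i a\<close>.
\<close>

lemma (in ring) left_depth_three_if_decomposition:
  fixes n :: nat
  assumes B: "subring B R" and C: "subring C R" and n: "0 < n"
    and p: "\<And>i. i < n \<Longrightarrow> p i \<in> hom (add_monoid R) (add_monoid R)"
    and p_right: "\<And>i x b. \<lbrakk>i < n; x \<in> carrier R; b \<in> B\<rbrakk> \<Longrightarrow> p i (x \<otimes> b) = p i x \<otimes> b"
    and p_left: "\<And>i c x. \<lbrakk>i < n; c \<in> C; x \<in> carrier R\<rbrakk> \<Longrightarrow> p i (c \<otimes> x) = c \<otimes> p i x"
    and p_sum: "\<And>x. x \<in> carrier R \<Longrightarrow> (\<Oplus>i\<in>{..<n}. p i x) = x"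
    and u: "\<And>i. i < n \<Longrightarrow> u i \<in> carrier R" and v: "\<And>i. i < n \<Longrightarrow> v i \<in> carrier R"
    and uv: "\<And>i. i < n \<Longrightarrow> u i \<otimes> v i = \<one>"
    and p_u: "\<And>i j. \<lbrakk>i < n; j < n\<rbrakk> \<Longrightarrow> p j (u i) = (if j = i then u i else \<zero>)"
    and v_p: "\<And>i x. \<lbrakk>i < n; x \<in> carrier R\<rbrakk> \<Longrightarrow> v i \<otimes> p i x \<in> B"
  shows "left_depth_three R B C"
proof -
  let ?V = "regular_bimodule R" and ?B = "R\<lparr>carrier := B\<rparr>" and ?C = "R\<lparr>carrier := C\<rparr>"
  note V = regular_bimodule_simps
  note bim = bimodule_regular_bimodule[OF ring_axioms]
  have BV: "bimodule ?B R ?V" and CV: "bimodule ?C R ?V"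
    using bim[OF B carrier_is_subring] bim[OF C carrier_is_subring] by simp_all
  interpret T: tensor_factors ?C ?B R ?V ?V
    using BV bim[OF C B] by (simp add: tensor_factors_def)
  have B_sub: "b \<in> carrier R" if "b \<in> B" for b using subringE(1)[OF B] that by blast
  have C_sub: "c \<in> carrier R" if "c \<in> C" for c using subringE(1)[OF C] that by blast
  have p_closed: "p i x \<in> carrier R" if "i < n" "x \<in> carrier R" for i x
    using hom_in_carrier[OF p] that by simp
  have p_add: "p i (x \<oplus> x') = p i x \<oplus> p i x'" if "i < n" "x \<in> carrier R" "x' \<in> carrier R" for i x x'
    using hom_mult[OF p] that by simp
  have "bimodule_iso ?C R T.T (power_bimodule n ?V) \<noteq> {}"
  proof (rule T.tensor_bimodule_iso_power[where f = "\<lambda>i x y. p i x \<otimes> y" and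
        \<sigma> = "\<lambda>i a. u i" and \<tau> = "\<lambda>i a. v i \<otimes> a", OF CV]; (unfold V)?)
    fix i assume i: "i < n"
    show "(\<lambda>a. pure_tensor ?B ?V ?V (u i) (v i \<otimes> a)) \<in> hom ?V T.T"
    proof (rule homI)
      fix a a' assume "a \<in> carrier ?V" "a' \<in> carrier ?V"
      then show "pure_tensor ?B ?V ?V (u i) (v i \<otimes> (a \<otimes>\<^bsub>?V\<^esub> a')) =
          pure_tensor ?B ?V ?V (u i) (v i \<otimes> a) \<otimes>\<^bsub>T.T\<^esub> pure_tensor ?B ?V ?V (u i) (v i \<otimes> a')"
        using T.pure_add_right[of "u i" "v i \<otimes> a" "v i \<otimes> a'"] i u v
        by (simp add: V r_distr)
    qed (use i u v T.pure_closed in \<open>simp add: V\<close>)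
  next
    fix i j a assume "i < n" "j < n" "a \<in> carrier R"
    then show "p j (u i) \<otimes> (v i \<otimes> a) = (if j = i then a else \<zero>)"
      using u v by (simp add: p_u m_assoc[symmetric] uv)
  next
    fix x y assume x: "x \<in> carrier R" and y: "y \<in> carrier R"
    have "(\<Otimes>\<^bsub>T.T\<^esub>i\<in>{..<n}. pure_tensor ?B ?V ?V (u i) (v i \<otimes> (p i x \<otimes> y))) =
        (\<Otimes>\<^bsub>T.T\<^esub>i\<in>{..<n}. pure_tensor ?B ?V ?V (p i x) y)"
    proof (rule T.T.finprod_cong'[OF refl])
      fix i assume "i \<in> {..<n}"
      then have i: "i < n" by simp
      have "pure_tensor ?B ?V ?V (u i) (v i \<otimes> (p i x \<otimes> y)) =
          pure_tensor ?B ?V ?V (u i) (lsmult ?V (v i \<otimes> p i x) y)"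
        using x y i v p_closed by (simp add: V m_assoc)
      also have "\<dots> = pure_tensor ?B ?V ?V (rsmult ?V (u i) (v i \<otimes> p i x)) y"
        using x y i u v_p by (intro T.pure_balanced[symmetric]) (simp_all add: V)
      also have "rsmult ?V (u i) (v i \<otimes> p i x) = p i x"
        using x i u v p_closed by (simp add: V m_assoc[symmetric] uv)
      finally show "pure_tensor ?B ?V ?V (u i) (v i \<otimes> (p i x \<otimes> y)) = pure_tensor ?B ?V ?V (p i x) y" .
    qed (use x y p_closed T.pure_closed in \<open>simp add: V Pi_iff\<close>)
    also have "\<dots> = pure_tensor ?B ?V ?V (finprod ?V (\<lambda>i. p i x) {..<n}) y"
    proof (rule hom_finprod[symmetric, OF T.M.comm_group_axioms T.T.comm_group_axioms])
      show "(\<lambda>x. pure_tensor ?B ?V ?V x y) \<in> hom ?V T.T"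
        using T.pure_closed[of _ y] T.pure_add_left[of _ _ y] y by (intro homI) (simp_all add: V)
    qed (use x p_closed in \<open>auto simp: V\<close>)
    also have "finprod ?V (\<lambda>i. p i x) {..<n} = x"
      using x by (simp add: finprod_regular_bimodule p_sum)
    finally show "(\<Otimes>\<^bsub>T.T\<^esub>i\<in>{..<n}. pure_tensor ?B ?V ?V (u i) (v i \<otimes> (p i x \<otimes> y))) =
        pure_tensor ?B ?V ?V x y" .
  qed (use u v p_closed B_sub C_sub in
      \<open>simp_all add: p_add p_left p_right l_distr r_distr m_assoc\<close>)
  then show ?thesis
    unfolding left_depth_three_def
    using n direct_summand_power_bimodule_self[OF CV]
    by (intro exI[of _ n] conjI exI[of _ "carrier (power_bimodule n ?V)"]) simp_all
qed

section \<open>Group algebras of finite groups\<close>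

locale finite_group_algebra = F: ring F + G: group G
  for F :: "('f, 'r) ring_scheme" and G :: "('g, 's) monoid_scheme" +
  assumes finite_G: "finite (carrier G)"
begin

abbreviation "A \<equiv> group_algebra F G"

lemma carrier_iff:
  "f \<in> carrier A \<longleftrightarrow> (\<forall>x\<in>carrier G. f x \<in> carrier F) \<and> (\<forall>x. x \<notin> carrier G \<longrightarrow> f x = \<zero>\<^bsub>F\<^esub>)"
proof -
  have "finite {x. f x \<noteq> \<zero>\<^bsub>F\<^esub>}" if "\<forall>x. x \<notin> carrier G \<longrightarrow> f x = \<zero>\<^bsub>F\<^esub>"
    by (rule finite_subset[OF _ finite_G]) (use that in blast)
  then show ?thesis by (auto simp: group_algebra_def)
qed

lemma carrier_subgroup_iff:
  assumes "subgroup H G"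
  shows "f \<in> carrier (group_algebra F (G\<lparr>carrier := H\<rparr>)) \<longleftrightarrow>
    f \<in> carrier A \<and> (\<forall>x. x \<notin> H \<longrightarrow> f x = \<zero>\<^bsub>F\<^esub>)"
proof -
  have "H \<subseteq> carrier G" using subgroup.subset[OF assms] .
  moreover have "f x \<in> carrier F" if "f x = \<zero>\<^bsub>F\<^esub>" for x using that by simp
  ultimately show ?thesis
    unfolding carrier_iff by (auto simp: group_algebra_def intro: finite_subset[OF _ finite_G])
qed

lemma apply_closed: "f \<in> carrier A \<Longrightarrow> f x \<in> carrier F"
  by (cases "x \<in> carrier G") (auto simp: carrier_iff)

lemma apply_outside: "\<lbrakk>f \<in> carrier A; x \<notin> carrier G\<rbrakk> \<Longrightarrow> f x = \<zero>\<^bsub>F\<^esub>"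
  by (auto simp: carrier_iff)

lemma group_algebra_eqI:
  assumes "f \<in> carrier A" "g \<in> carrier A" "\<And>x. x \<in> carrier G \<Longrightarrow> f x = g x"
  shows "f = g"
proof
  show "f x = g x" for x
    using assms by (cases "x \<in> carrier G") (auto simp: apply_outside)
qed

lemma zero_eq: "\<zero>\<^bsub>A\<^esub> = (\<lambda>x. \<zero>\<^bsub>F\<^esub>)"
  and add_apply: "(f \<oplus>\<^bsub>A\<^esub> g) x = f x \<oplus>\<^bsub>F\<^esub> g x"
  by (simp_all add: group_algebra_def)

text \<open>
  The product in the group algebra is a sum over the support of the left factor; for a finite group
  the sum may run over the whole group. Its range then no longer depends on that factor, so that
  distributivity can be read off term by term.
\<close>

lemma mult_apply:
  assumes "f \<in> carrier A" "g \<in> carrier A" "x \<in> carrier G"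
  shows "(f \<otimes>\<^bsub>A\<^esub> g) x = (\<Oplus>\<^bsub>F\<^esub>y\<in>carrier G. f y \<otimes>\<^bsub>F\<^esub> g (inv\<^bsub>G\<^esub> y \<otimes>\<^bsub>G\<^esub> x))"
proof -
  have "(f \<otimes>\<^bsub>A\<^esub> g) x =
      (\<Oplus>\<^bsub>F\<^esub>y\<in>{y \<in> carrier G. f y \<noteq> \<zero>\<^bsub>F\<^esub>}. f y \<otimes>\<^bsub>F\<^esub> g (inv\<^bsub>G\<^esub> y \<otimes>\<^bsub>G\<^esub> x))"
    using assms(3) by (simp add: group_algebra_def)
  also have "\<dots> = (\<Oplus>\<^bsub>F\<^esub>y\<in>carrier G. f y \<otimes>\<^bsub>F\<^esub> g (inv\<^bsub>G\<^esub> y \<otimes>\<^bsub>G\<^esub> x))"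
    using assms by (intro F.add.finprod_mono_neutral_cong_left) (auto simp: finite_G apply_closed)
  finally show ?thesis .
qed

lemma mult_closed: "\<lbrakk>f \<in> carrier A; g \<in> carrier A\<rbrakk> \<Longrightarrow> f \<otimes>\<^bsub>A\<^esub> g \<in> carrier A"
  unfolding carrier_iff[of "f \<otimes>\<^bsub>A\<^esub> g"]
  by (auto simp: mult_apply apply_closed intro!: F.finsum_closed) (simp add: group_algebra_def)

lemma mult_eq_zero:
  assumes "f \<in> carrier A" "g \<in> carrier A" "x \<in> carrier G"
    and "\<And>y. y \<in> carrier G \<Longrightarrow> f y = \<zero>\<^bsub>F\<^esub> \<or> g (inv\<^bsub>G\<^esub> y \<otimes>\<^bsub>G\<^esub> x) = \<zero>\<^bsub>F\<^esub>"
  shows "(f \<otimes>\<^bsub>A\<^esub> g) x = \<zero>\<^bsub>F\<^esub>"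
  unfolding mult_apply[OF assms(1-3)]
proof (rule F.add.finprod_one_eqI)
  show "f y \<otimes>\<^bsub>F\<^esub> g (inv\<^bsub>G\<^esub> y \<otimes>\<^bsub>G\<^esub> x) = \<zero>\<^bsub>F\<^esub>" if "y \<in> carrier G" for y
    using assms(4)[OF that] assms(1,2) by (auto simp: apply_closed)
qed

definition single :: "'g \<Rightarrow> 'g \<Rightarrow> 'f" where
  "single a = (\<lambda>x. if x = a then \<one>\<^bsub>F\<^esub> else \<zero>\<^bsub>F\<^esub>)"

lemma single_closed: "a \<in> carrier G \<Longrightarrow> single a \<in> carrier A"
  by (auto simp: carrier_iff single_def)

lemma one_eq: "\<one>\<^bsub>A\<^esub> = single \<one>\<^bsub>G\<^esub>"
  by (simp add: group_algebra_def single_def)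

lemma single_mult_apply:
  assumes a: "a \<in> carrier G" and f: "f \<in> carrier A" and x: "x \<in> carrier G"
  shows "(single a \<otimes>\<^bsub>A\<^esub> f) x = f (inv\<^bsub>G\<^esub> a \<otimes>\<^bsub>G\<^esub> x)"
proof -
  have "(single a \<otimes>\<^bsub>A\<^esub> f) x =
      (\<Oplus>\<^bsub>F\<^esub>y\<in>carrier G. if a = y then f (inv\<^bsub>G\<^esub> y \<otimes>\<^bsub>G\<^esub> x) else \<zero>\<^bsub>F\<^esub>)"
    unfolding mult_apply[OF single_closed[OF a] f x]
    using f by (intro F.finsum_cong') (auto simp: single_def apply_closed)
  also have "\<dots> = f (inv\<^bsub>G\<^esub> a \<otimes>\<^bsub>G\<^esub> x)"
    using a f by (intro F.finsum_singleton[where f = "\<lambda>y. f (inv\<^bsub>G\<^esub> y \<otimes>\<^bsub>G\<^esub> x)"])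
      (auto simp: apply_closed finite_G)
  finally show ?thesis .
qed

lemma mult_single_apply:
  assumes a: "a \<in> carrier G" and f: "f \<in> carrier A" and x: "x \<in> carrier G"
  shows "(f \<otimes>\<^bsub>A\<^esub> single a) x = f (x \<otimes>\<^bsub>G\<^esub> inv\<^bsub>G\<^esub> a)"
proof -
  have eq: "inv\<^bsub>G\<^esub> y \<otimes>\<^bsub>G\<^esub> x = a \<longleftrightarrow> x \<otimes>\<^bsub>G\<^esub> inv\<^bsub>G\<^esub> a = y" if "y \<in> carrier G" for y
    using that a x by (metis G.inv_solve_left' G.inv_solve_right')
  have "(f \<otimes>\<^bsub>A\<^esub> single a) x =
      (\<Oplus>\<^bsub>F\<^esub>y\<in>carrier G. if x \<otimes>\<^bsub>G\<^esub> inv\<^bsub>G\<^esub> a = y then f y else \<zero>\<^bsub>F\<^esub>)"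
    unfolding mult_apply[OF f single_closed[OF a] x]
    using f by (intro F.finsum_cong') (auto simp: single_def eq apply_closed)
  also have "\<dots> = f (x \<otimes>\<^bsub>G\<^esub> inv\<^bsub>G\<^esub> a)"
    using a f x by (intro F.finsum_singleton[where f = f]) (auto simp: apply_closed finite_G)
  finally show ?thesis .
qed

lemma single_mult_single:
  assumes "a \<in> carrier G" "b \<in> carrier G"
  shows "single a \<otimes>\<^bsub>A\<^esub> single b = single (a \<otimes>\<^bsub>G\<^esub> b)"
proof (rule group_algebra_eqI)
  show "(single a \<otimes>\<^bsub>A\<^esub> single b) x = single (a \<otimes>\<^bsub>G\<^esub> b) x" if "x \<in> carrier G" for x
    using assms that G.inv_solve_left'[of b a x]
    by (subst single_mult_apply) (auto simp: single_closed, auto simp: single_def)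
qed (use assms in \<open>simp_all add: mult_closed single_closed\<close>)

text \<open>
  Both sides are double sums over factorisations of \<open>x\<close> into three group elements; after exchanging
  the two sums, they differ by the substitution \<open>y = z w\<close> in the inner one.
\<close>

lemma mult_assoc:
  assumes f: "f \<in> carrier A" and g: "g \<in> carrier A" and h: "h \<in> carrier A"
  shows "(f \<otimes>\<^bsub>A\<^esub> g) \<otimes>\<^bsub>A\<^esub> h = f \<otimes>\<^bsub>A\<^esub> (g \<otimes>\<^bsub>A\<^esub> h)"
proof (rule group_algebra_eqI)
  fix x assume x: "x \<in> carrier G"
  have "((f \<otimes>\<^bsub>A\<^esub> g) \<otimes>\<^bsub>A\<^esub> h) x =
      (\<Oplus>\<^bsub>F\<^esub>y\<in>carrier G. \<Oplus>\<^bsub>F\<^esub>z\<in>carrier G.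
        f z \<otimes>\<^bsub>F\<^esub> (g (inv\<^bsub>G\<^esub> z \<otimes>\<^bsub>G\<^esub> y) \<otimes>\<^bsub>F\<^esub> h (inv\<^bsub>G\<^esub> y \<otimes>\<^bsub>G\<^esub> x)))"
    unfolding mult_apply[OF mult_closed[OF f g] h x]
  proof (rule F.finsum_cong'[OF refl])
    fix y assume y: "y \<in> carrier G"
    show "(f \<otimes>\<^bsub>A\<^esub> g) y \<otimes>\<^bsub>F\<^esub> h (inv\<^bsub>G\<^esub> y \<otimes>\<^bsub>G\<^esub> x) = (\<Oplus>\<^bsub>F\<^esub>z\<in>carrier G.
        f z \<otimes>\<^bsub>F\<^esub> (g (inv\<^bsub>G\<^esub> z \<otimes>\<^bsub>G\<^esub> y) \<otimes>\<^bsub>F\<^esub> h (inv\<^bsub>G\<^esub> y \<otimes>\<^bsub>G\<^esub> x)))"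
      using f g h by (simp add: mult_apply[OF f g y] F.finsum_ldistr[OF finite_G] apply_closed F.m_assoc)
  qed (use f g h in \<open>auto intro!: F.finsum_closed simp: apply_closed\<close>)
  also have "\<dots> = (\<Oplus>\<^bsub>F\<^esub>z\<in>carrier G. \<Oplus>\<^bsub>F\<^esub>y\<in>carrier G.
        f z \<otimes>\<^bsub>F\<^esub> (g (inv\<^bsub>G\<^esub> z \<otimes>\<^bsub>G\<^esub> y) \<otimes>\<^bsub>F\<^esub> h (inv\<^bsub>G\<^esub> y \<otimes>\<^bsub>G\<^esub> x)))"
    using f g h by (intro F.add.finprod_swap finite_G) (auto simp: apply_closed)
  also have "\<dots> = (f \<otimes>\<^bsub>A\<^esub> (g \<otimes>\<^bsub>A\<^esub> h)) x"
    unfolding mult_apply[OF f mult_closed[OF g h] x]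
  proof (rule F.finsum_cong'[OF refl])
    fix z assume z: "z \<in> carrier G"
    let ?t = "\<lambda>y. g (inv\<^bsub>G\<^esub> z \<otimes>\<^bsub>G\<^esub> y) \<otimes>\<^bsub>F\<^esub> h (inv\<^bsub>G\<^esub> y \<otimes>\<^bsub>G\<^esub> x)"
    have shift: "(\<lambda>w. z \<otimes>\<^bsub>G\<^esub> w) ` carrier G = carrier G"
      using z by (rule G.surj_const_mult)
    have "(\<Oplus>\<^bsub>F\<^esub>y\<in>carrier G. f z \<otimes>\<^bsub>F\<^esub> ?t y) = f z \<otimes>\<^bsub>F\<^esub> (\<Oplus>\<^bsub>F\<^esub>y\<in>carrier G. ?t y)"
      using f g h by (simp add: F.finsum_rdistr[OF finite_G] apply_closed)
    also have "(\<Oplus>\<^bsub>F\<^esub>y\<in>carrier G. ?t y) = (\<Oplus>\<^bsub>F\<^esub>y\<in>(\<lambda>w. z \<otimes>\<^bsub>G\<^esub> w) ` carrier G. ?t y)"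
      by (simp only: shift)
    also have "\<dots> = (\<Oplus>\<^bsub>F\<^esub>w\<in>carrier G. ?t (z \<otimes>\<^bsub>G\<^esub> w))"
      using g h z by (intro F.finsum_reindex) (auto simp: apply_closed G.inj_on_cmult)
    also have "\<dots> = (\<Oplus>\<^bsub>F\<^esub>w\<in>carrier G. g w \<otimes>\<^bsub>F\<^esub> h (inv\<^bsub>G\<^esub> w \<otimes>\<^bsub>G\<^esub> (inv\<^bsub>G\<^esub> z \<otimes>\<^bsub>G\<^esub> x)))"
      using g h x z by (intro F.finsum_cong')
        (auto simp: apply_closed G.inv_mult_group G.m_assoc[symmetric])
    also have "\<dots> = (g \<otimes>\<^bsub>A\<^esub> h) (inv\<^bsub>G\<^esub> z \<otimes>\<^bsub>G\<^esub> x)"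
      using x z by (simp add: mult_apply[OF g h])
    finally show "(\<Oplus>\<^bsub>F\<^esub>y\<in>carrier G. f z \<otimes>\<^bsub>F\<^esub> ?t y) = f z \<otimes>\<^bsub>F\<^esub> (g \<otimes>\<^bsub>A\<^esub> h) (inv\<^bsub>G\<^esub> z \<otimes>\<^bsub>G\<^esub> x)" .
  qed (use f g h in \<open>auto simp: apply_closed mult_closed\<close>)
  finally show "((f \<otimes>\<^bsub>A\<^esub> g) \<otimes>\<^bsub>A\<^esub> h) x = (f \<otimes>\<^bsub>A\<^esub> (g \<otimes>\<^bsub>A\<^esub> h)) x" .
qed (use f g h in \<open>simp_all add: mult_closed\<close>)

lemma add_closed: "\<lbrakk>f \<in> carrier A; g \<in> carrier A\<rbrakk> \<Longrightarrow> f \<oplus>\<^bsub>A\<^esub> g \<in> carrier A"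
  by (auto simp: carrier_iff add_apply)

sublocale A: ring A
proof (rule ringI)
  show "abelian_group A"
  proof (rule abelian_groupI)
    show "\<exists>g\<in>carrier A. g \<oplus>\<^bsub>A\<^esub> f = \<zero>\<^bsub>A\<^esub>" if f: "f \<in> carrier A" for f
    proof
      show "(\<lambda>x. \<ominus>\<^bsub>F\<^esub> f x) \<in> carrier A" using f by (auto simp: carrier_iff)
      show "(\<lambda>x. \<ominus>\<^bsub>F\<^esub> f x) \<oplus>\<^bsub>A\<^esub> f = \<zero>\<^bsub>A\<^esub>"
        using f by (auto simp: fun_eq_iff add_apply zero_eq apply_closed F.l_neg)
    qed
    show "f \<oplus>\<^bsub>A\<^esub> g = g \<oplus>\<^bsub>A\<^esub> f" if "f \<in> carrier A" "g \<in> carrier A" for f g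
      using that by (auto simp: fun_eq_iff add_apply apply_closed intro: F.a_comm)
    show "\<zero>\<^bsub>A\<^esub> \<in> carrier A" by (simp add: carrier_iff zero_eq)
  qed (simp_all add: add_closed add_apply zero_eq fun_eq_iff apply_closed F.a_assoc)
  show "monoid A"
  proof (rule monoidI)
    show "\<one>\<^bsub>A\<^esub> \<in> carrier A" by (simp add: one_eq single_closed)
    show "\<one>\<^bsub>A\<^esub> \<otimes>\<^bsub>A\<^esub> f = f" if "f \<in> carrier A" for f
      by (rule group_algebra_eqI) (use that in \<open>simp_all add: one_eq mult_closed single_closed single_mult_apply\<close>)
    show "f \<otimes>\<^bsub>A\<^esub> \<one>\<^bsub>A\<^esub> = f" if "f \<in> carrier A" for f
      by (rule group_algebra_eqI) (use that in \<open>simp_all add: one_eq mult_closed single_closed mult_single_apply\<close>)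
  qed (simp_all add: mult_closed mult_assoc)
  fix f g h assume fgh: "f \<in> carrier A" "g \<in> carrier A" "h \<in> carrier A"
  show "(f \<oplus>\<^bsub>A\<^esub> g) \<otimes>\<^bsub>A\<^esub> h = f \<otimes>\<^bsub>A\<^esub> h \<oplus>\<^bsub>A\<^esub> g \<otimes>\<^bsub>A\<^esub> h"
    by (rule group_algebra_eqI) (use fgh in \<open>simp_all add: add_closed mult_closed add_apply mult_apply apply_closed
        F.l_distr F.finsum_addf\<close>)
  show "h \<otimes>\<^bsub>A\<^esub> (f \<oplus>\<^bsub>A\<^esub> g) = h \<otimes>\<^bsub>A\<^esub> f \<oplus>\<^bsub>A\<^esub> h \<otimes>\<^bsub>A\<^esub> g"
    by (rule group_algebra_eqI) (use fgh in \<open>simp_all add: add_closed mult_closed add_apply mult_apply apply_closed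
        F.r_distr F.finsum_addf\<close>)
qed

lemma finsum_apply:
  assumes "finite I" "f \<in> I \<rightarrow> carrier A"
  shows "(finsum A f I) x = (\<Oplus>\<^bsub>F\<^esub>i\<in>I. f i x)"
  using assms
proof (induction I)
  case empty
  then show ?case by (simp add: zero_eq)
next
  case (insert i I)
  then have "(\<lambda>i. f i x) \<in> I \<rightarrow> carrier F" "f i x \<in> carrier F" by (auto simp: apply_closed Pi_iff)
  with insert show ?case by (simp add: add_apply)
qed

lemma subring_subgroup:
  assumes H: "subgroup H G"
  shows "subring (carrier (group_algebra F (G\<lparr>carrier := H\<rparr>))) A"
proof -
  interpret H: subgroup H G by (rule H)
  note H_iff = carrier_subgroup_iff[OF H]
  have inv_mult: "x \<in> H" if "y \<in> H" "inv\<^bsub>G\<^esub> y \<otimes>\<^bsub>G\<^esub> x \<in> H" "x \<in> carrier G" for x y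
    using that H.m_closed[OF that(1,2)] by (simp add: G.m_assoc[symmetric])
  show ?thesis
  proof (rule A.subringI)
    fix f g assume f: "f \<in> carrier (group_algebra F (G\<lparr>carrier := H\<rparr>))"
      and g: "g \<in> carrier (group_algebra F (G\<lparr>carrier := H\<rparr>))"
    have "(f \<otimes>\<^bsub>A\<^esub> g) x = \<zero>\<^bsub>F\<^esub>" if "x \<notin> H" for x
    proof (cases "x \<in> carrier G")
      case True
      then show ?thesis
        using f g that inv_mult by (intro mult_eq_zero) (auto simp: H_iff)
    qed (use f g in \<open>simp add: H_iff apply_outside mult_closed\<close>)
    then show "f \<otimes>\<^bsub>A\<^esub> g \<in> carrier (group_algebra F (G\<lparr>carrier := H\<rparr>))"
      using f g by (simp add: H_iff)
    show "f \<oplus>\<^bsub>A\<^esub> g \<in> carrier (group_algebra F (G\<lparr>carrier := H\<rparr>))"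
      using f g by (simp add: H_iff add_apply)
  next
    fix f assume f: "f \<in> carrier (group_algebra F (G\<lparr>carrier := H\<rparr>))"
    have "\<ominus>\<^bsub>A\<^esub> f = (\<lambda>x. \<ominus>\<^bsub>F\<^esub> f x)"
      by (rule A.minus_equality)
        (use f in \<open>auto simp: H_iff carrier_iff[of "\<lambda>x. \<ominus>\<^bsub>F\<^esub> f x"] fun_eq_iff add_apply zero_eq
          apply_closed apply_outside F.l_neg\<close>)
    then show "\<ominus>\<^bsub>A\<^esub> f \<in> carrier (group_algebra F (G\<lparr>carrier := H\<rparr>))"
      using f A.a_inv_closed[of f] by (simp add: H_iff)
  next
    show "\<one>\<^bsub>A\<^esub> \<in> carrier (group_algebra F (G\<lparr>carrier := H\<rparr>))"
      by (auto simp: H_iff one_eq single_closed) (auto simp: single_def)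
  qed (auto simp: H_iff)
qed

end

section \<open>Restriction to parts of the group\<close>

context finite_group_algebra
begin

definition restr :: "'g set \<Rightarrow> ('g \<Rightarrow> 'f) \<Rightarrow> 'g \<Rightarrow> 'f" where
  "restr S f = (\<lambda>x. if x \<in> S then f x else \<zero>\<^bsub>F\<^esub>)"

lemma restr_closed: "f \<in> carrier A \<Longrightarrow> restr S f \<in> carrier A"
  by (auto simp: carrier_iff restr_def)

lemma restr_hom: "restr S \<in> hom (add_monoid A) (add_monoid A)"
  by (rule homI) (simp_all add: restr_closed, simp add: restr_def add_apply fun_eq_iff)

text \<open>
  Left multiplication by an element supported on \<open>H\<close> moves coefficients only within right cosets of
  \<open>H\<close>, so it commutes with restriction to a union of such cosets.
\<close>

lemma restr_mult_left:
  assumes b: "b \<in> carrier (group_algebra F (G\<lparr>carrier := H\<rparr>))" and H: "subgroup H G"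
    and f: "f \<in> carrier A"
    and S: "\<And>h x. \<lbrakk>h \<in> H; x \<in> carrier G\<rbrakk> \<Longrightarrow> inv\<^bsub>G\<^esub> h \<otimes>\<^bsub>G\<^esub> x \<in> S \<longleftrightarrow> x \<in> S"
  shows "restr S (b \<otimes>\<^bsub>A\<^esub> f) = b \<otimes>\<^bsub>A\<^esub> restr S f"
proof -
  have bA: "b \<in> carrier A" and b0: "\<And>x. x \<notin> H \<Longrightarrow> b x = \<zero>\<^bsub>F\<^esub>"
    using b by (auto simp: carrier_subgroup_iff[OF H])
  show ?thesis
  proof (rule group_algebra_eqI)
    fix x assume x: "x \<in> carrier G"
    show "restr S (b \<otimes>\<^bsub>A\<^esub> f) x = (b \<otimes>\<^bsub>A\<^esub> restr S f) x"
    proof (cases "x \<in> S")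
      case True
      have "b y \<otimes>\<^bsub>F\<^esub> f (inv\<^bsub>G\<^esub> y \<otimes>\<^bsub>G\<^esub> x) = b y \<otimes>\<^bsub>F\<^esub> restr S f (inv\<^bsub>G\<^esub> y \<otimes>\<^bsub>G\<^esub> x)" for y
        using S[OF _ x, of y] b0[of y] True f by (cases "y \<in> H") (auto simp: restr_def apply_closed)
      with True show ?thesis
        using bA f x by (simp add: restr_def[of S "b \<otimes>\<^bsub>A\<^esub> f"] mult_apply restr_closed)
    next
      case False
      have "(b \<otimes>\<^bsub>A\<^esub> restr S f) x = \<zero>\<^bsub>F\<^esub>"
        using False S[OF _ x] b0 by (intro mult_eq_zero bA restr_closed f x) (auto simp: restr_def)
      with False show ?thesis by (simp add: restr_def)
    qed
  qed (use bA f in \<open>simp_all add: restr_closed\<close>)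
qed

text \<open>
  Likewise for right multiplication and unions of left cosets.
\<close>

lemma restr_mult_right:
  assumes b: "b \<in> carrier (group_algebra F (G\<lparr>carrier := H\<rparr>))" and H: "subgroup H G"
    and f: "f \<in> carrier A"
    and S: "\<And>x h. \<lbrakk>x \<in> carrier G; h \<in> H\<rbrakk> \<Longrightarrow> x \<otimes>\<^bsub>G\<^esub> h \<in> S \<longleftrightarrow> x \<in> S"
  shows "restr S (f \<otimes>\<^bsub>A\<^esub> b) = restr S f \<otimes>\<^bsub>A\<^esub> b"
proof -
  have bA: "b \<in> carrier A" and b0: "\<And>x. x \<notin> H \<Longrightarrow> b x = \<zero>\<^bsub>F\<^esub>"
    using b by (auto simp: carrier_subgroup_iff[OF H])
  have S': "y \<in> S \<longleftrightarrow> x \<in> S" if "x \<in> carrier G" "y \<in> carrier G" "inv\<^bsub>G\<^esub> y \<otimes>\<^bsub>G\<^esub> x \<in> H" for x y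
    using S[OF that(2,3)] that(1,2) by (simp add: G.m_assoc[symmetric])
  show ?thesis
  proof (rule group_algebra_eqI)
    fix x assume x: "x \<in> carrier G"
    show "restr S (f \<otimes>\<^bsub>A\<^esub> b) x = (restr S f \<otimes>\<^bsub>A\<^esub> b) x"
    proof (cases "x \<in> S")
      case True
      have "f y \<otimes>\<^bsub>F\<^esub> b (inv\<^bsub>G\<^esub> y \<otimes>\<^bsub>G\<^esub> x) = restr S f y \<otimes>\<^bsub>F\<^esub> b (inv\<^bsub>G\<^esub> y \<otimes>\<^bsub>G\<^esub> x)"
        if "y \<in> carrier G" for y
        using S'[OF x that] b0[of "inv\<^bsub>G\<^esub> y \<otimes>\<^bsub>G\<^esub> x"] True f bA
        by (cases "inv\<^bsub>G\<^esub> y \<otimes>\<^bsub>G\<^esub> x \<in> H") (auto simp: restr_def apply_closed)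
      then have "(\<Oplus>\<^bsub>F\<^esub>y\<in>carrier G. f y \<otimes>\<^bsub>F\<^esub> b (inv\<^bsub>G\<^esub> y \<otimes>\<^bsub>G\<^esub> x)) =
          (\<Oplus>\<^bsub>F\<^esub>y\<in>carrier G. restr S f y \<otimes>\<^bsub>F\<^esub> b (inv\<^bsub>G\<^esub> y \<otimes>\<^bsub>G\<^esub> x))"
        using bA f by (intro F.finsum_cong') (auto simp: apply_closed restr_closed)
      with True show ?thesis
        using bA f x by (simp add: restr_def[of S "f \<otimes>\<^bsub>A\<^esub> b"] mult_apply restr_closed)
    next
      case False
      have "(restr S f \<otimes>\<^bsub>A\<^esub> b) x = \<zero>\<^bsub>F\<^esub>"
        using False S'[OF x] b0 by (intro mult_eq_zero bA restr_closed f x) (auto simp: restr_def)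
      with False show ?thesis by (simp add: restr_def)
    qed
  qed (use bA f in \<open>simp_all add: restr_closed\<close>)
qed

lemma finsum_restr:
  assumes S: "\<And>x. x \<in> carrier G \<Longrightarrow> \<exists>!i. i \<in> I \<and> x \<in> S i" and "finite I" and f: "f \<in> carrier A"
  shows "(\<Oplus>\<^bsub>A\<^esub>i\<in>I. restr (S i) f) = f"
proof (rule group_algebra_eqI)
  fix x assume x: "x \<in> carrier G"
  obtain j where j: "j \<in> I" "x \<in> S j" and j_unique: "\<And>i. \<lbrakk>i \<in> I; x \<in> S i\<rbrakk> \<Longrightarrow> i = j"
    using S[OF x] by blast
  have "(\<Oplus>\<^bsub>A\<^esub>i\<in>I. restr (S i) f) x = (\<Oplus>\<^bsub>F\<^esub>i\<in>I. restr (S i) f x)"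
    using assms(2) f by (intro finsum_apply) (auto simp: restr_closed)
  also have "\<dots> = (\<Oplus>\<^bsub>F\<^esub>i\<in>I. if j = i then f x else \<zero>\<^bsub>F\<^esub>)"
  proof (rule F.finsum_cong'[OF refl])
    show "restr (S i) f x = (if j = i then f x else \<zero>\<^bsub>F\<^esub>)" if "i \<in> I" for i
      using that j(2) j_unique[OF that] by (cases "j = i") (auto simp: restr_def)
  qed (use f in \<open>simp add: apply_closed\<close>)
  also have "\<dots> = f x"
    using f j assms(2) by (intro F.finsum_singleton[where f = "\<lambda>_. f x"]) (auto simp: apply_closed)
  finally show "(\<Oplus>\<^bsub>A\<^esub>i\<in>I. restr (S i) f) x = f x" .
qed (use f in \<open>auto simp: restr_closed intro!: A.finsum_closed\<close>)

lemma restr_single: "restr S (single a) = (if a \<in> S then single a else \<zero>\<^bsub>A\<^esub>)"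
  by (auto simp: restr_def single_def zero_eq fun_eq_iff)

end

text \<open>
  The condition on \<open>x\<close> says that it lies in the right coset of \<open>t i\<close>. Formulated in this way it also
  yields a transversal for the left cosets, by applying it to the inverse of \<open>x\<close>.
\<close>

lemma (in group) ex_right_transversal:
  assumes H: "subgroup H G" and fin: "finite (carrier G)"
  obtains n :: nat and t where "0 < n" "\<And>i. i < n \<Longrightarrow> t i \<in> carrier G"
    "\<And>x. x \<in> carrier G \<Longrightarrow> \<exists>!i. i \<in> {..<n} \<and> x \<otimes> inv (t i) \<in> H"
proof -
  interpret H: subgroup H G by (rule H)
  have "finite (rcosets H)"
    using fin by (simp add: RCOSETS_def)
  then obtain e where e: "bij_betw e {..<card (rcosets H)} (rcosets H)"
    using ex_bij_betw_nat_finite atLeast0LessThan by metis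
  let ?n = "card (rcosets H)"
  have "\<exists>x\<in>carrier G. e i = H #> x" if "i < ?n" for i
    using bij_betwE[OF e] that by (force simp: RCOSETS_def)
  then obtain t where t: "\<And>i. i < ?n \<Longrightarrow> t i \<in> carrier G" "\<And>i. i < ?n \<Longrightarrow> e i = H #> t i"
    by metis
  have mem: "x \<otimes> inv (t i) \<in> H \<longleftrightarrow> H #> x = e i" if "i < ?n" "x \<in> carrier G" for i x
    using that t H.rcos_module[OF group_axioms t(1)[OF that(1)] that(2)]
      repr_independence[of x H "t i"] repr_independenceD[OF H that(2), of "t i"] H by metis
  show thesis
  proof (rule that[of ?n t])
    have "H #> \<one> \<in> rcosets H" by (simp add: RCOSETS_def) (use one_closed in blast)
    then show "0 < ?n" using \<open>finite (rcosets H)\<close> by (auto simp: card_gt_0_iff)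
    fix x assume x: "x \<in> carrier G"
    then have "H #> x \<in> rcosets H" by (auto simp: RCOSETS_def)
    then have "\<exists>!i. i \<in> {..<?n} \<and> H #> x = e i"
      using e unfolding bij_betw_def inj_on_def by (metis (no_types, lifting) imageE)
    moreover have "(i \<in> {..<?n} \<and> H #> x = e i) = (i \<in> {..<?n} \<and> x \<otimes> inv (t i) \<in> H)" for i
      using mem[OF _ x] by auto
    ultimately show "\<exists>!i. i \<in> {..<?n} \<and> x \<otimes> inv (t i) \<in> H" by simp
  qed (use t in auto)
qed

section \<open>Depth three from the normal closure\<close>

lemma conjugate_in_normal_closure:
  assumes "group G" "k \<in> K" "g \<in> carrier G"
  shows "g \<otimes>\<^bsub>G\<^esub> k \<otimes>\<^bsub>G\<^esub> inv\<^bsub>G\<^esub> g \<in> normal_closure G K"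
  unfolding normal_closure_def using assms normal.inv_op_closed2 by fastforce

context finite_group_algebra
begin

context
  fixes H K
  assumes H: "subgroup H G" and K: "subgroup K G"
    and conj: "\<And>g k. \<lbrakk>g \<in> carrier G; k \<in> K\<rbrakk> \<Longrightarrow> g \<otimes>\<^bsub>G\<^esub> k \<otimes>\<^bsub>G\<^esub> inv\<^bsub>G\<^esub> g \<in> H"
begin

interpretation H: subgroup H G by (rule H)
interpretation K: subgroup K G by (rule K)

lemma mult_mem_left_iff: "\<lbrakk>h \<in> H; x \<in> carrier G\<rbrakk> \<Longrightarrow> h \<otimes>\<^bsub>G\<^esub> x \<in> H \<longleftrightarrow> x \<in> H"
  using H.m_closed[of "inv\<^bsub>G\<^esub> h" "h \<otimes>\<^bsub>G\<^esub> x"] by (auto simp: G.m_assoc[symmetric])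

lemma mult_mem_right_iff: "\<lbrakk>h \<in> H; x \<in> carrier G\<rbrakk> \<Longrightarrow> x \<otimes>\<^bsub>G\<^esub> h \<in> H \<longleftrightarrow> x \<in> H"
  using H.m_closed[of "x \<otimes>\<^bsub>G\<^esub> h" "inv\<^bsub>G\<^esub> h"] by (auto simp: G.m_assoc)

text \<open>
  The criterion is applied to the restrictions to the right cosets \<open>H t\<^sub>i\<close>. These sets are stable under
  left multiplication by \<open>H\<close>, and also under right multiplication by \<open>K\<close>, because
  \<open>t\<^sub>i k = (t\<^sub>i k t\<^sub>i\<^sup>-\<^sup>1) t\<^sub>i\<close>. This is where the conjugates of \<open>K\<close> have to lie in \<open>H\<close>.
\<close>

lemma right_depth_three_group_algebra:
  "right_depth_three A (carrier (group_algebra F (G\<lparr>carrier := H\<rparr>)))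
     (carrier (group_algebra F (G\<lparr>carrier := K\<rparr>)))"
proof -
  obtain n and t :: "nat \<Rightarrow> 'g" where n: "0 < n" and t: "\<And>i. i < n \<Longrightarrow> t i \<in> carrier G"
    and t_unique: "\<And>x. x \<in> carrier G \<Longrightarrow> \<exists>!i. i \<in> {..<n} \<and> x \<otimes>\<^bsub>G\<^esub> inv\<^bsub>G\<^esub> (t i) \<in> H"
    using G.ex_right_transversal[OF H finite_G] by blast
  define S where "S i = {x \<in> carrier G. x \<otimes>\<^bsub>G\<^esub> inv\<^bsub>G\<^esub> (t i) \<in> H}" for i
  show ?thesis
  proof (rule A.right_depth_three_if_decomposition[where p = "\<lambda>i. restr (S i)" and
        u = "\<lambda>i. single (t i)" and v = "\<lambda>i. single (inv\<^bsub>G\<^esub> (t i))",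
        OF subring_subgroup[OF H] subring_subgroup[OF K] n restr_hom])
    fix i assume i: "i < n"
    show "restr (S i) (b \<otimes>\<^bsub>A\<^esub> y) = b \<otimes>\<^bsub>A\<^esub> restr (S i) y"
      if "b \<in> carrier (group_algebra F (G\<lparr>carrier := H\<rparr>))" "y \<in> carrier A" for b y
      using that t[OF i] mult_mem_left_iff
      by (intro restr_mult_left[OF _ H]) (auto simp: S_def G.m_assoc)
    show "restr (S i) (y \<otimes>\<^bsub>A\<^esub> c) = restr (S i) y \<otimes>\<^bsub>A\<^esub> c"
      if y: "y \<in> carrier A" and c: "c \<in> carrier (group_algebra F (G\<lparr>carrier := K\<rparr>))" for y c
    proof (rule restr_mult_right[OF c K y])
      fix x k assume x: "x \<in> carrier G" and k: "k \<in> K"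
      let ?c = "t i \<otimes>\<^bsub>G\<^esub> k \<otimes>\<^bsub>G\<^esub> inv\<^bsub>G\<^esub> (t i)"
      have kG: "k \<in> carrier G" using k by (rule K.mem_carrier)
      have cancel: "inv\<^bsub>G\<^esub> (t i) \<otimes>\<^bsub>G\<^esub> (t i \<otimes>\<^bsub>G\<^esub> z) = z" if "z \<in> carrier G" for z
        using that t[OF i] by (simp add: G.m_assoc[symmetric])
      have "x \<otimes>\<^bsub>G\<^esub> k \<otimes>\<^bsub>G\<^esub> inv\<^bsub>G\<^esub> (t i) = x \<otimes>\<^bsub>G\<^esub> inv\<^bsub>G\<^esub> (t i) \<otimes>\<^bsub>G\<^esub> ?c"
        using x kG t[OF i] by (simp add: G.m_assoc cancel)
      moreover have "?c \<in> H" using conj t[OF i] k by blast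
      ultimately show "x \<otimes>\<^bsub>G\<^esub> k \<in> S i \<longleftrightarrow> x \<in> S i"
        using x kG t[OF i] mult_mem_right_iff[of ?c "x \<otimes>\<^bsub>G\<^esub> inv\<^bsub>G\<^esub> (t i)"] by (simp add: S_def)
    qed
    show "restr (S i) y \<otimes>\<^bsub>A\<^esub> single (inv\<^bsub>G\<^esub> (t i)) \<in> carrier (group_algebra F (G\<lparr>carrier := H\<rparr>))"
      if y: "y \<in> carrier A" for y
      unfolding carrier_subgroup_iff[OF H]
    proof (intro conjI allI impI)
      let ?f = "restr (S i) y \<otimes>\<^bsub>A\<^esub> single (inv\<^bsub>G\<^esub> (t i))"
      show f: "?f \<in> carrier A" using y t[OF i] by (simp add: restr_closed single_closed)
      fix x assume "x \<notin> H"
      then show "?f x = \<zero>\<^bsub>F\<^esub>"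
      proof (cases "x \<in> carrier G")
        case True
        then show ?thesis
          using \<open>x \<notin> H\<close> y t[OF i]
          by (subst mult_single_apply) (simp_all add: restr_closed, simp add: restr_def S_def G.m_assoc)
      qed (use f in \<open>simp add: apply_outside\<close>)
    qed
  next
    fix i j assume i: "i < n" and j: "j < n"
    have "t i \<otimes>\<^bsub>G\<^esub> inv\<^bsub>G\<^esub> (t i) \<in> H" using t[OF i] by simp
    then have "t i \<in> S j \<longleftrightarrow> j = i"
      using t_unique[OF t[OF i]] i j t[OF i] by (auto simp: S_def)
    then show "restr (S j) (single (t i)) = (if j = i then single (t i) else \<zero>\<^bsub>A\<^esub>)"
      by (simp add: restr_single)
  next
    fix y assume "y \<in> carrier A"
    then show "(\<Oplus>\<^bsub>A\<^esub>i\<in>{..<n}. restr (S i) y) = y"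
      using t_unique by (intro finsum_restr) (simp_all add: S_def)
  qed (use t in \<open>simp_all add: single_closed single_mult_single one_eq\<close>)
qed

text \<open>
  Here the pieces are the left cosets \<open>t\<^sub>i\<^sup>-\<^sup>1 H\<close>, which are stable under left multiplication by \<open>K\<close>
  because \<open>k t\<^sub>i\<^sup>-\<^sup>1 = t\<^sub>i\<^sup>-\<^sup>1 (t\<^sub>i k t\<^sub>i\<^sup>-\<^sup>1)\<close>.
\<close>

lemma left_depth_three_group_algebra:
  "left_depth_three A (carrier (group_algebra F (G\<lparr>carrier := H\<rparr>)))
     (carrier (group_algebra F (G\<lparr>carrier := K\<rparr>)))"
proof -
  obtain n and t :: "nat \<Rightarrow> 'g" where n: "0 < n" and t: "\<And>i. i < n \<Longrightarrow> t i \<in> carrier G"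
    and t_unique: "\<And>x. x \<in> carrier G \<Longrightarrow> \<exists>!i. i \<in> {..<n} \<and> x \<otimes>\<^bsub>G\<^esub> inv\<^bsub>G\<^esub> (t i) \<in> H"
    using G.ex_right_transversal[OF H finite_G] by blast
  define S where "S i = {x \<in> carrier G. t i \<otimes>\<^bsub>G\<^esub> x \<in> H}" for i
  have S_unique: "\<exists>!i. i \<in> {..<n} \<and> x \<in> S i" if x: "x \<in> carrier G" for x
  proof -
    have "t i \<otimes>\<^bsub>G\<^esub> x \<in> H \<longleftrightarrow> inv\<^bsub>G\<^esub> x \<otimes>\<^bsub>G\<^esub> inv\<^bsub>G\<^esub> (t i) \<in> H" if "i < n" for i
      using H.m_inv_closed[of "t i \<otimes>\<^bsub>G\<^esub> x"] H.m_inv_closed[of "inv\<^bsub>G\<^esub> x \<otimes>\<^bsub>G\<^esub> inv\<^bsub>G\<^esub> (t i)"] x t[OF that]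
      by (auto simp: G.inv_mult_group)
    then have "(i \<in> {..<n} \<and> x \<in> S i) = (i \<in> {..<n} \<and> inv\<^bsub>G\<^esub> x \<otimes>\<^bsub>G\<^esub> inv\<^bsub>G\<^esub> (t i) \<in> H)" for i
      using x by (auto simp: S_def)
    then show ?thesis using t_unique[of "inv\<^bsub>G\<^esub> x"] x by simp
  qed
  show ?thesis
  proof (rule A.left_depth_three_if_decomposition[where p = "\<lambda>i. restr (S i)" and
        u = "\<lambda>i. single (inv\<^bsub>G\<^esub> (t i))" and v = "\<lambda>i. single (t i)",
        OF subring_subgroup[OF H] subring_subgroup[OF K] n restr_hom])
    fix i assume i: "i < n"
    show "restr (S i) (x \<otimes>\<^bsub>A\<^esub> b) = restr (S i) x \<otimes>\<^bsub>A\<^esub> b"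
      if "x \<in> carrier A" "b \<in> carrier (group_algebra F (G\<lparr>carrier := H\<rparr>))" for x b
      using that t[OF i] mult_mem_right_iff
      by (intro restr_mult_right[OF _ H]) (auto simp: S_def G.m_assoc[symmetric])
    show "restr (S i) (c \<otimes>\<^bsub>A\<^esub> y) = c \<otimes>\<^bsub>A\<^esub> restr (S i) y"
      if c: "c \<in> carrier (group_algebra F (G\<lparr>carrier := K\<rparr>))" and y: "y \<in> carrier A" for c y
    proof (rule restr_mult_left[OF c K y])
      fix k x assume k: "k \<in> K" and x: "x \<in> carrier G"
      let ?c = "t i \<otimes>\<^bsub>G\<^esub> inv\<^bsub>G\<^esub> k \<otimes>\<^bsub>G\<^esub> inv\<^bsub>G\<^esub> (t i)"
      have kG: "k \<in> carrier G" using k by (rule K.mem_carrier)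
      have cancel: "inv\<^bsub>G\<^esub> (t i) \<otimes>\<^bsub>G\<^esub> (t i \<otimes>\<^bsub>G\<^esub> z) = z" if "z \<in> carrier G" for z
        using that t[OF i] by (simp add: G.m_assoc[symmetric])
      have "t i \<otimes>\<^bsub>G\<^esub> (inv\<^bsub>G\<^esub> k \<otimes>\<^bsub>G\<^esub> x) = ?c \<otimes>\<^bsub>G\<^esub> (t i \<otimes>\<^bsub>G\<^esub> x)"
        using x kG t[OF i] by (simp add: G.m_assoc cancel)
      moreover have "?c \<in> H" using conj t[OF i] K.m_inv_closed[OF k] by blast
      ultimately show "inv\<^bsub>G\<^esub> k \<otimes>\<^bsub>G\<^esub> x \<in> S i \<longleftrightarrow> x \<in> S i"
        using x kG t[OF i] mult_mem_left_iff[of ?c "t i \<otimes>\<^bsub>G\<^esub> x"] by (simp add: S_def)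
    qed
    show "single (t i) \<otimes>\<^bsub>A\<^esub> restr (S i) y \<in> carrier (group_algebra F (G\<lparr>carrier := H\<rparr>))"
      if y: "y \<in> carrier A" for y
      unfolding carrier_subgroup_iff[OF H]
    proof (intro conjI allI impI)
      let ?f = "single (t i) \<otimes>\<^bsub>A\<^esub> restr (S i) y"
      show f: "?f \<in> carrier A" using y t[OF i] by (simp add: restr_closed single_closed)
      fix x assume "x \<notin> H"
      then show "?f x = \<zero>\<^bsub>F\<^esub>"
      proof (cases "x \<in> carrier G")
        case True
        then show ?thesis
          using \<open>x \<notin> H\<close> y t[OF i]
          by (subst single_mult_apply)
            (simp_all add: restr_closed, simp add: restr_def S_def G.m_assoc[symmetric])
      qed (use f in \<open>simp add: apply_outside\<close>)
    qed
  next
    fix i j assume i: "i < n" and j: "j < n"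
    have "inv\<^bsub>G\<^esub> (t i) \<in> S i" using t[OF i] by (simp add: S_def)
    then have "inv\<^bsub>G\<^esub> (t i) \<in> S j \<longleftrightarrow> j = i"
      using S_unique[of "inv\<^bsub>G\<^esub> (t i)"] i j t[OF i] by auto
    then show "restr (S j) (single (inv\<^bsub>G\<^esub> (t i))) = (if j = i then single (inv\<^bsub>G\<^esub> (t i)) else \<zero>\<^bsub>A\<^esub>)"
      by (simp add: restr_single)
  next
    fix y assume "y \<in> carrier A"
    then show "(\<Oplus>\<^bsub>A\<^esub>i\<in>{..<n}. restr (S i) y) = y"
      using S_unique by (intro finsum_restr) simp_all
  qed (use t in \<open>simp_all add: single_closed single_mult_single one_eq\<close>)
qed

end

end

theorem theorem3p1:
  fixes F :: "('f, 'r) ring_scheme" and G :: "('g, 's) monoid_scheme"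
  assumes "ring F"
    and "group G" and "finite (carrier G)"
    and "subgroup H G" and "subgroup K (G\<lparr>carrier := H\<rparr>)"
    and "normal_closure G K \<subseteq> H"
  shows "depth_three (group_algebra F G)
           (carrier (group_algebra F (G\<lparr>carrier := H\<rparr>)))
           (carrier (group_algebra F (G\<lparr>carrier := K\<rparr>)))"
proof -
  interpret finite_group_algebra F G
    using assms(1-3) by (simp add: finite_group_algebra_def finite_group_algebra_axioms_def)
  have K: "subgroup K G"
    using G.incl_subgroup[OF assms(4,5)] .
  have KH: "K \<subseteq> H"
    using subgroup.subset[OF assms(5)] by simp
  have conj: "g \<otimes>\<^bsub>G\<^esub> k \<otimes>\<^bsub>G\<^esub> inv\<^bsub>G\<^esub> g \<in> H" if "g \<in> carrier G" "k \<in> K" for g k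
    using conjugate_in_normal_closure[OF assms(2) that(2,1)] assms(6) by blast
  have "carrier (group_algebra F (G\<lparr>carrier := K\<rparr>)) \<subseteq> carrier (group_algebra F (G\<lparr>carrier := H\<rparr>))"
    using KH by (auto simp: carrier_subgroup_iff[OF K] carrier_subgroup_iff[OF assms(4)] subset_iff)
  then have "ring_tower A (carrier (group_algebra F (G\<lparr>carrier := H\<rparr>)))
      (carrier (group_algebra F (G\<lparr>carrier := K\<rparr>)))"
    using subring_subgroup[OF assms(4)] subring_subgroup[OF K] A.ring_axioms
    by (simp add: ring_tower_def)
  then show ?thesis
    using right_depth_three_group_algebra[OF assms(4) K conj]
      left_depth_three_group_algebra[OF assms(4) K conj]
    by (simp add: depth_three_def)
qed

end
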